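(* Let $m,n\ge 1$ and $1\le k\le m$ be integers, let $\alpha\in\mathbb{R}$ and $B\in M_{m,n}$, and let $\Phi^{-}_{\alpha,B}:M_n\to M_m$ be $\Phi^{-}_{\alpha,B}(X)=\alpha\,\mathrm{tr}(X)I_m-BXB^*$. The following are equivalent: (i) $\Phi^{-}_{\alpha,B}$ is $k$-PPT; (ii) $\Phi^{-}_{\alpha,B}$ is $k$-positive; (iii) $\alpha\ge\sum_{j=1}^k\sigma_j(B)^2$.
   Context: $M_{m,n}$ is the set of $m\times n$ complex matrices, $M_n=M_{n,n}$. Singular values of $B$ are $\sigma_1(B)\ge\sigma_2(B)\ge\cdots\ge\sigma_{\min\{m,n\}}(B)\ge 0$, with the convention $\sigma_j(B)=0$ for $j>\min\{m,n\}$. For a block matrix $A=[A_{ij}]_{i,j=1}^k$ with square blocks, the partial transpose is $A^\tau=[A_{ji}]_{i,j=1}^k$ (blocks are swapped but not themselves transposed); $A$ is PPT if both $A$ and $A^\tau$ are positive semidefinite. A linear map $\Phi:M_n\to M_m$ is $k$-positive if $[\Phi(A_{ij})]_{i,j=1}^k$ is positive semidefinite for every positive semidefinite $[A_{ij}]_{i,j=1}^k$ with $A_{ij}\in M_n$, and $k$-PPT if $[\Phi(A_{ij})]_{i,j=1}^k$ is PPT for every such positive semidefinite $[A_{ij}]_{i,j=1}^k$. *)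

theory Defs
  imports
    "HOL-Computational_Algebra.Fundamental_Theorem_Algebra"
    "Jordan_Normal_Form.Schur_Decomposition"
begin

definition mat_trace :: "'a :: comm_monoid_add mat \<Rightarrow> 'a" where
  "mat_trace A = (\<Sum>i<dim_row A. A $$ (i, i))"

text \<open>The quadratic form \<open>(A *\<^sub>v v) \<bullet>c v\<close> is v* A v; on complex numbers, \<open>0 \<le> z\<close> says that
  \<open>z\<close> is real and nonnegative (theory Complex_Order).\<close>

definition positive_semidefinite :: "complex mat \<Rightarrow> bool" where
  "positive_semidefinite A \<longleftrightarrow> square_mat A \<and> mat_adjoint A = A \<and>
     (\<forall>v \<in> carrier_vec (dim_row A). 0 \<le> (A *\<^sub>v v) \<bullet>c v)"

text \<open>A block matrix is given by the family of its blocks: \<open>A i j\<close>, for \<open>i, j < k\<close>, is the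
  \<open>n \<times> n\<close> block in block row \<open>i\<close> and block column \<open>j\<close>, counted from 0.  \<open>block_matrix k n A\<close>
  assembles the \<open>kn \<times> kn\<close> matrix.\<close>

definition block_matrix :: "nat \<Rightarrow> nat \<Rightarrow> (nat \<Rightarrow> nat \<Rightarrow> 'a mat) \<Rightarrow> 'a mat" where
  "block_matrix k n A =
     mat (k * n) (k * n) (\<lambda>(r, c). A (r div n) (c div n) $$ (r mod n, c mod n))"

definition partial_transpose :: "(nat \<Rightarrow> nat \<Rightarrow> 'a mat) \<Rightarrow> nat \<Rightarrow> nat \<Rightarrow> 'a mat" where
  "partial_transpose A = (\<lambda>i j. A j i)"

definition PPT :: "nat \<Rightarrow> nat \<Rightarrow> (nat \<Rightarrow> nat \<Rightarrow> complex mat) \<Rightarrow> bool" where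
  "PPT k n A \<longleftrightarrow> positive_semidefinite (block_matrix k n A) \<and>
     positive_semidefinite (block_matrix k n (partial_transpose A))"

definition linear_mat_map :: "nat \<Rightarrow> nat \<Rightarrow> (complex mat \<Rightarrow> complex mat) \<Rightarrow> bool" where
  "linear_mat_map n m \<Phi> \<longleftrightarrow>
     (\<forall>X \<in> carrier_mat n n. \<Phi> X \<in> carrier_mat m m) \<and>
     (\<forall>X \<in> carrier_mat n n. \<forall>Y \<in> carrier_mat n n. \<Phi> (X + Y) = \<Phi> X + \<Phi> Y) \<and>
     (\<forall>c. \<forall>X \<in> carrier_mat n n. \<Phi> (c \<cdot>\<^sub>m X) = c \<cdot>\<^sub>m \<Phi> X)"

definition k_positive :: "nat \<Rightarrow> nat \<Rightarrow> nat \<Rightarrow> (complex mat \<Rightarrow> complex mat) \<Rightarrow> bool" where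
  "k_positive k n m \<Phi> \<longleftrightarrow> linear_mat_map n m \<Phi> \<and>
     (\<forall>A. (\<forall>i<k. \<forall>j<k. A i j \<in> carrier_mat n n) \<longrightarrow>
          positive_semidefinite (block_matrix k n A) \<longrightarrow>
          positive_semidefinite (block_matrix k m (\<lambda>i j. \<Phi> (A i j))))"

definition k_PPT :: "nat \<Rightarrow> nat \<Rightarrow> nat \<Rightarrow> (complex mat \<Rightarrow> complex mat) \<Rightarrow> bool" where
  "k_PPT k n m \<Phi> \<longleftrightarrow> linear_mat_map n m \<Phi> \<and>
     (\<forall>A. (\<forall>i<k. \<forall>j<k. A i j \<in> carrier_mat n n) \<longrightarrow>
          positive_semidefinite (block_matrix k n A) \<longrightarrow>
          PPT k m (\<lambda>i j. \<Phi> (A i j)))"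

text \<open>The square roots of the eigenvalues of B* B, with multiplicity, in decreasing order.
  The eigenvalues are real and nonnegative, so taking \<open>Re\<close> loses nothing.\<close>

definition singular_value_list :: "complex mat \<Rightarrow> real list" where
  "singular_value_list B = rev (sorted_list_of_multiset
     (image_mset (\<lambda>z. sqrt (Re z)) (proots (char_poly (mat_adjoint B * B)))))"

text \<open>Singular values are indexed from 1.  For \<open>B\<close> of size \<open>m \<times> n\<close> the list has length \<open>n\<close>; by
  convention the values with index beyond \<open>min m n\<close> are 0.\<close>

definition singular_value :: "complex mat \<Rightarrow> nat \<Rightarrow> real" where
  "singular_value B j =
     (if 1 \<le> j \<and> j \<le> min (dim_row B) (dim_col B) then singular_value_list B ! (j - 1) else 0)"

text \<open>The size \<open>m\<close> of the target is the number of rows of \<open>B\<close>.\<close>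

definition Phi_minus :: "real \<Rightarrow> complex mat \<Rightarrow> complex mat \<Rightarrow> complex mat" where
  "Phi_minus \<alpha> B X =
     (complex_of_real \<alpha> * mat_trace X) \<cdot>\<^sub>m 1\<^sub>m (dim_row B) - B * X * mat_adjoint B"

end

theory Submission
  imports Defs "HOL-Analysis.Convex"
begin

text \<open>
  A positive semidefinite block matrix is a sum of rank one matrices \<open>x x*\<close> with \<open>x = (x\<^sub>1, \<dots>, x\<^sub>k)\<close>.
  For such a matrix, the quadratic form of the image under the map at \<open>w = (w\<^sub>1, \<dots>, w\<^sub>k)\<close> is
  \<open>\<alpha> \<parallel>Y\<parallel>\<^sup>2 - |tr (B Y)|\<^sup>2\<close> with the Frobenius norm and \<open>Y = \<Sum>\<^sub>i x\<^sub>i w\<^sub>i*\<close>, a matrix of rank at most \<open>k\<close>.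
  Factoring \<open>Y = \<Sum>\<^sub>l q\<^sub>l u\<^sub>l*\<close> with at most \<open>k\<close> orthonormal vectors \<open>q\<^sub>l\<close>, Cauchy-Schwarz gives
  \<open>|tr (B Y)|\<^sup>2 \<le> \<Sum>\<^sub>l \<parallel>B q\<^sub>l\<parallel>\<^sup>2 \<cdot> \<parallel>Y\<parallel>\<^sup>2\<close>, and Ky Fan's inequality bounds the first factor by the sum
  of the \<open>k\<close> largest \<open>\<sigma>\<^sub>j\<^sup>2\<close>. Equality holds when \<open>x\<^sub>i\<close> runs through right singular vectors and \<open>w\<^sub>i = B x\<^sub>i\<close>.

  For the partial transpose the quadratic form is \<open>\<alpha> \<parallel>U\<parallel>\<^sup>2 - tr (N* N\<^sup>T)\<close> with
  \<open>U = \<Sum>\<^sub>i x\<^sub>i w\<^sub>i\<^sup>T\<close> and \<open>N = B U\<close>. Here \<open>|tr (N* N\<^sup>T)| \<le> \<parallel>N\<parallel>\<^sup>2 \<le> \<sigma>\<^sub>1\<^sup>2 \<parallel>U\<parallel>\<^sup>2\<close>,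
  so \<open>\<alpha> \<ge> \<sigma>\<^sub>1\<^sup>2\<close> already suffices for this half of the PPT property.
\<close>

subsection \<open>Unitary diagonalization of Hermitian matrices\<close>

lemma mat_adjoint_carrier [simp]: "A \<in> carrier_mat n m \<Longrightarrow> mat_adjoint A \<in> carrier_mat m n"
  unfolding mat_adjoint_def by (auto simp: mat_of_rows_def)

lemma dim_mat_adjoint [simp]: "dim_row (mat_adjoint A) = dim_col A" "dim_col (mat_adjoint A) = dim_row A"
  unfolding mat_adjoint_def by (auto simp: mat_of_rows_def)

lemma index_mat_adjoint [simp]:
  fixes A :: "complex mat"
  shows "i < dim_col A \<Longrightarrow> j < dim_row A \<Longrightarrow> mat_adjoint A $$ (i, j) = cnj (A $$ (j, i))"
  unfolding mat_adjoint_def by (auto simp: mat_of_rows_def)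

lemma mat_adjoint_adjoint [simp]: "mat_adjoint (mat_adjoint A) = (A :: complex mat)"
  by (rule eq_matI) auto

lemma index_mult_mat_sum:
  "A \<in> carrier_mat n m \<Longrightarrow> B \<in> carrier_mat m l \<Longrightarrow> i < n \<Longrightarrow> j < l \<Longrightarrow>
    (A * B) $$ (i, j) = (\<Sum>s<m. A $$ (i, s) * B $$ (s, j))"
  by (auto simp: scalar_prod_def atLeast0LessThan)

lemma mat_adjoint_mult:
  fixes A :: "complex mat"
  assumes "A \<in> carrier_mat n m" "B \<in> carrier_mat m l"
  shows "mat_adjoint (A * B) = mat_adjoint B * mat_adjoint A"
  by (rule eq_matI) (use assms in \<open>auto simp: scalar_prod_def mult.commute\<close>)

lemma sandwich_assoc:
  fixes A :: "'a :: semiring_0 mat"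
  assumes c: "P \<in> carrier_mat n n" "Q \<in> carrier_mat n n" "A \<in> carrier_mat n n" "R \<in> carrier_mat n n" "S \<in> carrier_mat n n"
  shows "(P * Q) * A * (R * S) = P * (Q * A * R) * S"
  using assoc_mult_mat[OF c(1,2,3)] assoc_mult_mat[OF c(1) mult_carrier_mat[OF c(2,3)] mult_carrier_mat[OF c(4,5)]]
    assoc_mult_mat[OF mult_carrier_mat[OF c(2,3)] c(4,5)]
    assoc_mult_mat[OF c(1) mult_carrier_mat[OF mult_carrier_mat[OF c(2,3)] c(4)] c(5)]
  by simp

text \<open>Basis completion and Gram-Schmidt yield pairwise orthogonal columns starting with
  \<open>v\<close>. Dividing each column by its norm makes the matrix unitary, so \<open>c\<close>
  is the reciprocal of the norm of \<open>v\<close>.\<close>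

lemma unitary_first_column:
  fixes v :: "complex vec"
  assumes v: "v \<in> carrier_vec n" "v \<noteq> 0\<^sub>v n"
  obtains W c where "W \<in> carrier_mat n n" "mat_adjoint W * W = 1\<^sub>m n" "col W 0 = c \<cdot>\<^sub>v v"
proof -
  have n: "0 < n" using v by (cases n) auto
  interpret cof_vec_space n "TYPE(complex)" .
  define b where "b = basis_completion v"
  define ws where "ws = gram_schmidt n b"
  define W where "W = mat_of_cols n ws"
  note b = basis_completion[OF v, folded b_def]
  obtain vs where bv: "b = v # vs" using b(6,7) n by (cases b) auto
  from gram_schmidt_result[OF b(2,4,5) refl, folded ws_def]
  have ws: "set ws \<subseteq> carrier_vec n" "corthogonal ws" "length ws = n" by (auto simp: b(6))
  \<comment> \<open>Gram-Schmidt leaves the head of its list unchanged.\<close>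
  have hd: "hd ws = v" using gram_schmidt_hd[OF v(1), of vs, folded bv] by (simp add: ws_def)
  have W: "W \<in> carrier_mat n n" using ws by (auto simp: W_def)
  define d where "d j = (\<Sum>l<n. (cmod (W $$ (l, j)))\<^sup>2)" for j
  have orth: "(\<Sum>l<n. cnj (W $$ (l, i)) * W $$ (l, j)) = (if i = j then of_real (d j) else 0)
      \<and> d j > 0" if ij: "i < n" "j < n" for i j
  proof -
    have "corthogonal_mat W" unfolding W_def by (rule orthogonal_mat_of_cols[OF ws])
    from this[unfolded corthogonal_mat_def Let_def diagonal_mat_def] W ij
    have 1: "i \<noteq> j \<Longrightarrow> (mat_adjoint W * W) $$ (i, j) = 0" and 2: "(mat_adjoint W * W) $$ (j, j) \<noteq> 0" by auto
    have 3: "(mat_adjoint W * W) $$ (i, j) = (\<Sum>l<n. cnj (W $$ (l, i)) * W $$ (l, j))" if "i < n" for i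
      using W ij that by (subst index_mult_mat_sum[of _ n n _ n]) auto
    have 4: "(\<Sum>l<n. cnj (W $$ (l, j)) * W $$ (l, j)) = of_real (d j)"
      unfolding d_def of_real_sum by (intro sum.cong) (simp_all add: complex_norm_square mult.commute del: of_real_power)
    have "d j \<ge> 0" unfolding d_def by (intro sum_nonneg) auto
    then show ?thesis using 1 2 3[OF ij(1)] 3[OF ij(2)] 4 by auto
  qed
  define V where "V = mat n n (\<lambda>(i, j). W $$ (i, j) / of_real (sqrt (d j)))"
  have V: "V \<in> carrier_mat n n" by (simp add: V_def)
  show thesis
  proof (rule that[OF V])
    show "mat_adjoint V * V = 1\<^sub>m n"
    proof (rule eq_matI)
      fix i j assume "i < dim_row (1\<^sub>m n :: complex mat)" "j < dim_col (1\<^sub>m n :: complex mat)"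
      then have ij: "i < n" "j < n" by auto
      have "(mat_adjoint V * V) $$ (i, j) = (\<Sum>l<n. cnj (W $$ (l, i)) * W $$ (l, j)) / (of_real (sqrt (d i)) * of_real (sqrt (d j)))"
        using V ij by (subst index_mult_mat_sum[of _ n n _ n]) (auto simp: V_def sum_divide_distrib)
      also have "\<dots> = (1\<^sub>m n) $$ (i, j)"
        using orth[OF ij] ij by (auto simp flip: of_real_mult)
      finally show "(mat_adjoint V * V) $$ (i, j) = (1\<^sub>m n) $$ (i, j)" .
    qed (use V in auto)
    show "col V 0 = (1 / of_real (sqrt (d 0))) \<cdot>\<^sub>v v"
    proof (rule eq_vecI)
      fix i assume "i < dim_vec ((1 / complex_of_real (sqrt (d 0))) \<cdot>\<^sub>v v)"
      then have i: "i < n" using v by auto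
      have "ws ! 0 = v" using hd ws(3) n by (metis hd_conv_nth length_0_conv less_numeral_extra(3))
      then show "col V 0 $ i = ((1 / complex_of_real (sqrt (d 0))) \<cdot>\<^sub>v v) $ i"
        using i n v ws by (auto simp: V_def W_def mat_of_cols_def)
    qed (use V v in auto)
  qed
qed

text \<open>Deflation, by induction on the list of roots: a unitary \<open>W\<close> whose first
  column is an eigenvector for the head of \<open>es\<close> splits \<open>A\<close> into a 1 by 1
  block and a Hermitian block with the remaining roots. The diagonal keeps the order of
  \<open>es\<close>; this later allows it to be prescribed as the decreasing order of the singular
  values.\<close>

theorem hermitian_diagonalization:
  fixes A :: "complex mat"
  assumes "A \<in> carrier_mat n n" "mat_adjoint A = A" "char_poly A = (\<Prod>e\<leftarrow>es. [:- e, 1:])"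
  shows "\<exists>U \<in> carrier_mat n n. mat_adjoint U * U = 1\<^sub>m n \<and> mat_adjoint U * A * U = mat_diag n (\<lambda>i. es ! i)"
  using assms
proof (induction es arbitrary: n A)
  case Nil
  with degree_monic_char_poly[of A n] have "n = 0" by auto
  then show ?case using Nil by (intro bexI[of _ "1\<^sub>m n"] conjI eq_matI) (auto simp: mat_diag_def)
next
  case (Cons e es n A)
  note A = Cons(2) and herm = Cons(3)
  let ?q = "\<Prod>e\<leftarrow>es. [:- e, 1:]"
  have cp: "char_poly A = [: -e, 1 :] * ?q" using Cons by auto
  have "monic ?q" by (rule monic_prod_list) auto
  then have "degree (char_poly A) = Suc (degree ?q)" unfolding cp
    by (subst degree_mult_eq) auto
  with degree_monic_char_poly[OF A] obtain p where n: "n = Suc p" by (cases n) auto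
  have "eigenvalue A e" unfolding eigenvalue_root_char_poly[OF A] cp by simp
  then obtain v where v: "v \<in> carrier_vec n" "v \<noteq> 0\<^sub>v n" and Av: "A *\<^sub>v v = e \<cdot>\<^sub>v v"
    using A unfolding eigenvalue_def eigenvector_def by auto
  obtain W c where W: "W \<in> carrier_mat n n" and WW: "mat_adjoint W * W = 1\<^sub>m n" and col: "col W 0 = c \<cdot>\<^sub>v v"
    using unitary_first_column[OF v] .
  have aW: "mat_adjoint W \<in> carrier_mat n n" using W by simp
  have WW': "W * mat_adjoint W = 1\<^sub>m n" using mat_mult_left_right_inverse[OF aW W WW] .
  define A' where "A' = mat_adjoint W * A * W"
  have A': "A' \<in> carrier_mat n n" using W aW A by (auto simp: A'_def)
  have A'_herm: "mat_adjoint A' = A'"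
    unfolding A'_def mat_adjoint_mult[OF mult_carrier_mat[OF aW A] W] mat_adjoint_mult[OF aW A]
    using W aW A by (simp add: herm assoc_mult_mat[of _ n n _ n _ n])
  have "A *\<^sub>v (c \<cdot>\<^sub>v v) = c \<cdot>\<^sub>v (A *\<^sub>v v)" using A v by (simp add: mult_mat_vec)
  also have "\<dots> = e \<cdot>\<^sub>v (c \<cdot>\<^sub>v v)" by (simp add: Av smult_smult_assoc mult.commute)
  finally have eig: "A *\<^sub>v col W 0 = e \<cdot>\<^sub>v col W 0" by (simp add: col)
  have "col A' 0 = mat_adjoint W *\<^sub>v (A *\<^sub>v col W 0)"
    unfolding A'_def assoc_mult_mat[OF aW A W]
    using col_mult2[OF aW mult_carrier_mat[OF A W], of 0] col_mult2[OF A W, of 0] n by (simp only: zero_less_Suc)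
  also have "\<dots> = e \<cdot>\<^sub>v (mat_adjoint W *\<^sub>v col W 0)" unfolding eig by (rule mult_mat_vec[OF aW]) (use W in auto)
  also have "mat_adjoint W *\<^sub>v col W 0 = col (mat_adjoint W * W) 0"
    using col_mult2[OF aW W, of 0] n by (simp only: zero_less_Suc)
  finally have col0: "col A' 0 = e \<cdot>\<^sub>v col (1\<^sub>m n) 0" by (simp add: WW)
  have A'i0: "A' $$ (i, 0) = (if i = 0 then e else 0)" if "i < n" for i
    using arg_cong[OF col0, of "\<lambda>v. v $ i"] that A' n by auto
  \<comment> \<open>Hermitian symmetry carries the zeros of the first column over to the first row,
    so \<open>A'\<close> is block diagonal.\<close>
  have A'0i: "A' $$ (0, i) = (if i = 0 then e else 0)" if "i < n" for i
    using A'i0[OF that] A'i0[of 0] index_mat_adjoint[of 0 A' i] index_mat_adjoint[of 0 A' 0] that A' n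
    unfolding A'_herm by auto
  define A3 where "A3 = mat p p (\<lambda>(i, j). A' $$ (Suc i, Suc j))"
  have A3: "A3 \<in> carrier_mat p p" by (simp add: A3_def)
  let ?E = "mat 1 1 (\<lambda>_. e)"
  have A'4: "A' = four_block_mat ?E (0\<^sub>m 1 p) (0\<^sub>m p 1) A3"
    by (rule eq_matI) (use A' n A'i0 A'0i in \<open>auto simp: A3_def\<close>)
  have "similar_mat_wit A' A (mat_adjoint W) W"
    by (rule similar_mat_witI[of _ _ n]) (use W aW A A' WW WW' in \<open>auto simp: A'_def\<close>)
  then have "similar_mat A' A" unfolding similar_mat_def by blast
  from char_poly_similar[OF this] have "char_poly A' = [: -e, 1 :] * ?q" by (simp add: cp)
  also have "char_poly A' = char_poly ?E * char_poly A3"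
    unfolding A'4 by (rule char_poly_four_block_zeros_col) (use A3 in auto)
  also have "char_poly ?E = [: -e, 1 :]"
    by (simp add: char_poly_defs det_def sign_def)
  \<comment> \<open>Cancelling the linear factor of \<open>e\<close> leaves exactly the remaining
    roots, as the induction hypothesis requires.\<close>
  finally have cp3: "char_poly A3 = ?q"
    by (metis mult_cancel_left pCons_eq_0_iff zero_neq_one)
  have "mat_adjoint A3 = A3"
  proof (rule eq_matI)
    fix i j assume "i < dim_row A3" "j < dim_col A3"
    then have ij: "i < p" "j < p" using A3 by auto
    then have "cnj (A' $$ (Suc j, Suc i)) = A' $$ (Suc i, Suc j)"
      using index_mat_adjoint[of "Suc i" A' "Suc j"] A' n unfolding A'_herm by auto
    then show "mat_adjoint A3 $$ (i, j) = A3 $$ (i, j)" using ij by (auto simp: A3_def)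
  qed (use A3 in auto)
  from Cons.IH[OF A3 this cp3] obtain U where U: "U \<in> carrier_mat p p" "mat_adjoint U * U = 1\<^sub>m p"
    and diag: "mat_adjoint U * A3 * U = mat_diag p (\<lambda>i. es ! i)" by auto
  let ?U = "four_block_mat (1\<^sub>m 1) (0\<^sub>m 1 p) (0\<^sub>m p 1) U"
  let ?aU = "four_block_mat (1\<^sub>m 1) (0\<^sub>m 1 p) (0\<^sub>m p 1) (mat_adjoint U)"
  have cU: "?U \<in> carrier_mat n n" "?aU \<in> carrier_mat n n" using U n by auto
  have aU: "mat_adjoint ?U = ?aU"
    by (rule eq_matI) (use U in auto)
  have aWU: "mat_adjoint (W * ?U) = ?aU * mat_adjoint W"
    using W cU aU by (simp add: mat_adjoint_mult[of _ n n _ n])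
  have blocks: "?aU * four_block_mat F (0\<^sub>m 1 p) (0\<^sub>m p 1) G * ?U = four_block_mat F (0\<^sub>m 1 p) (0\<^sub>m p 1) (mat_adjoint U * G * U)"
    if "F \<in> carrier_mat 1 1" "G \<in> carrier_mat p p" for F G
  proof -
    have *: "four_block_mat F (0\<^sub>m 1 p) (0\<^sub>m p 1) G * four_block_mat F' (0\<^sub>m 1 p) (0\<^sub>m p 1) G'
      = four_block_mat (F * F') (0\<^sub>m 1 p) (0\<^sub>m p 1) (G * G')"
      if "F \<in> carrier_mat 1 1" "G \<in> carrier_mat p p" "F' \<in> carrier_mat 1 1" "G' \<in> carrier_mat p p" for F F' G G' :: "complex mat"
      using that mult_carrier_mat[OF that(2,4)] mult_carrier_mat[OF that(1,3)]
      by (subst mult_four_block_mat[OF that(1) _ _ that(2,3) _ _ that(4)]) auto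
    note aUc = mat_adjoint_carrier[OF U(1)]
    show ?thesis
      unfolding *[OF one_carrier_mat aUc that]
        *[OF mult_carrier_mat[OF one_carrier_mat that(1)] mult_carrier_mat[OF aUc that(2)] one_carrier_mat U(1)]
      using that by simp
  qed
  show ?case
  proof (intro bexI conjI)
    show "W * ?U \<in> carrier_mat n n" using W cU by auto
    have "mat_adjoint (W * ?U) * (W * ?U) = ?aU * (mat_adjoint W * W) * ?U"
      unfolding aWU using sandwich_assoc[OF cU(2) aW one_carrier_mat W cU(1)] aW W cU by simp
    also have "\<dots> = ?aU * four_block_mat (1\<^sub>m 1) (0\<^sub>m 1 p) (0\<^sub>m p 1) (1\<^sub>m p) * ?U"
      by (simp add: WW n)
    also have "\<dots> = 1\<^sub>m n" using U by (subst blocks) (auto simp: n)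
    finally show "mat_adjoint (W * ?U) * (W * ?U) = 1\<^sub>m n" .
    have "mat_adjoint (W * ?U) * A * (W * ?U) = ?aU * A' * ?U"
      unfolding aWU A'_def by (rule sandwich_assoc[OF cU(2) aW A W cU(1)])
    also have "\<dots> = four_block_mat ?E (0\<^sub>m 1 p) (0\<^sub>m p 1) (mat_diag p (\<lambda>i. es ! i))"
      unfolding A'4 using A3 by (subst blocks) (auto simp: diag)
    also have "\<dots> = mat_diag n (\<lambda>i. (e # es) ! i)"
      by (rule eq_matI) (auto simp: n mat_diag_def nth_Cons')
    finally show "mat_adjoint (W * ?U) * A * (W * ?U) = mat_diag n (\<lambda>i. (e # es) ! i)" .
  qed
qed

subsection \<open>Orthonormal families\<close>

text \<open>Vectors are encoded as functions of which only the values below \<open>n\<close> count;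
  families of vectors and their linear combinations then carry no dimension conditions.\<close>

definition cinner :: "nat \<Rightarrow> (nat \<Rightarrow> complex) \<Rightarrow> (nat \<Rightarrow> complex) \<Rightarrow> complex" where
  "cinner n f g = (\<Sum>s<n. f s * cnj (g s))"

lemma cinner_sum_left: "cinner n (\<lambda>s. \<Sum>i\<in>I. c i * q i s) g = (\<Sum>i\<in>I. c i * cinner n (q i) g)"
  unfolding cinner_def sum_distrib_left sum_distrib_right by (subst sum.swap) (simp add: mult.assoc)

lemma cnj_cinner: "cnj (cinner n f g) = cinner n g f"
  by (simp add: cinner_def mult.commute)

lemma cinner_diff_left: "cinner n (\<lambda>s. f s - g s) h = cinner n f h - cinner n g h"
  by (simp add: cinner_def algebra_simps sum_subtractf)

lemma cinner_diff_right: "cinner n h (\<lambda>s. f s - g s) = cinner n h f - cinner n h g"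
  by (simp add: cinner_def algebra_simps sum_subtractf)

lemma cinner_smult_left: "cinner n (\<lambda>s. c * f s) g = c * cinner n f g"
  by (simp add: cinner_def sum_distrib_left mult.assoc)

lemma cinner_smult_right: "cinner n f (\<lambda>s. c * g s) = cnj c * cinner n f g"
  by (simp add: cinner_def sum_distrib_left mult.left_commute)

lemma cinner_cong: "(\<And>s. s < n \<Longrightarrow> f s = f' s) \<Longrightarrow> (\<And>s. s < n \<Longrightarrow> g s = g' s) \<Longrightarrow> cinner n f g = cinner n f' g'"
  by (simp add: cinner_def)

lemma cinner_self: "cinner n f f = of_real (\<Sum>s<n. (cmod (f s))\<^sup>2)"
  unfolding cinner_def of_real_sum by (intro sum.cong) (simp_all only: complex_norm_square)

text \<open>Pythagoras: the cross terms vanish. The squared norms \<open>d i\<close> stay general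
  because the rule serves both orthonormal vectors, with \<open>d i = 1\<close>, and the images
  under \<open>B\<close> of right singular vectors.\<close>

lemma cinner_sum_sum:
  assumes "finite I" "\<And>i j. i \<in> I \<Longrightarrow> j \<in> I \<Longrightarrow> cinner n (q i) (q j) = (if i = j then of_real (d i) else 0)"
  shows "(\<Sum>s<n. (cmod (\<Sum>i\<in>I. c i * q i s))\<^sup>2) = (\<Sum>i\<in>I. d i * (cmod (c i))\<^sup>2)"
proof -
  let ?f = "\<lambda>s. \<Sum>i\<in>I. c i * q i s"
  have *: "cinner n (q i) ?f = cnj (c i) * of_real (d i)" if "i \<in> I" for i
  proof -
    have "cinner n (q i) ?f = cnj (cinner n ?f (q i))" by (simp add: cnj_cinner)
    also have "\<dots> = cnj (\<Sum>j\<in>I. c j * cinner n (q j) (q i))" by (simp only: cinner_sum_left)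
    also have "(\<Sum>j\<in>I. c j * cinner n (q j) (q i)) = (\<Sum>j\<in>I. if j = i then c i * of_real (d i) else 0)"
      using that assms(2) by (intro sum.cong) auto
    finally show ?thesis using that assms(1) by simp
  qed
  have "complex_of_real (\<Sum>s<n. (cmod (?f s))\<^sup>2) = cinner n ?f ?f" by (simp only: cinner_self)
  also have "\<dots> = (\<Sum>i\<in>I. c i * cinner n (q i) ?f)" by (rule cinner_sum_left)
  also have "\<dots> = (\<Sum>i\<in>I. of_real (d i * (cmod (c i))\<^sup>2))"
    unfolding of_real_mult complex_norm_square by (intro sum.cong) (auto simp: * mult_ac)
  finally show ?thesis unfolding of_real_sum[symmetric] of_real_eq_iff .
qed

text \<open>The index set is arbitrary because the orthonormalization below keeps only some of the
  indices.\<close>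

definition orthonormal_family :: "nat \<Rightarrow> nat set \<Rightarrow> (nat \<Rightarrow> nat \<Rightarrow> complex) \<Rightarrow> bool" where
  "orthonormal_family n I q \<longleftrightarrow> (\<forall>i\<in>I. \<forall>j\<in>I. cinner n (q i) (q j) = (if i = j then 1 else 0))"

lemma orthonormal_family_remainder:
  assumes "finite I" "orthonormal_family n I q" "j \<in> I"
  shows "cinner n (\<lambda>s. f s - (\<Sum>i\<in>I. cinner n f (q i) * q i s)) (q j) = 0"
proof -
  have "(\<Sum>i\<in>I. cinner n f (q i) * cinner n (q i) (q j)) = (\<Sum>i\<in>I. if i = j then cinner n f (q j) else 0)"
    using assms by (intro sum.cong) (auto simp: orthonormal_family_def)
  then show ?thesis using assms by (simp add: cinner_diff_left cinner_sum_left)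
qed

text \<open>The remainder of \<open>f\<close> after projection onto the family is orthogonal to the
  projection, so its squared norm is the difference of the two sides.\<close>

lemma bessel_inequality:
  assumes "finite I" "orthonormal_family n I q"
  shows "(\<Sum>i\<in>I. (cmod (cinner n f (q i)))\<^sup>2) \<le> (\<Sum>s<n. (cmod (f s))\<^sup>2)"
proof -
  let ?c = "\<lambda>i. cinner n f (q i)"
  let ?g = "\<lambda>s. \<Sum>i\<in>I. ?c i * q i s"
  let ?r = "\<lambda>s. f s - ?g s"
  have "cinner n ?r ?g = cnj (\<Sum>i\<in>I. ?c i * cinner n (q i) ?r)" unfolding cinner_sum_left[symmetric] by (simp add: cnj_cinner)
  also have "\<dots> = (\<Sum>i\<in>I. cnj (?c i) * cinner n ?r (q i))" by (simp add: cnj_cinner)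
  also have "\<dots> = 0" using orthonormal_family_remainder[OF assms] by simp
  finally have "cinner n ?r ?r = cinner n ?r f" by (simp add: cinner_diff_right[of _ ?r])
  also have "\<dots> = cinner n f f - (\<Sum>i\<in>I. ?c i * cinner n (q i) f)" by (simp add: cinner_diff_left cinner_sum_left)
  also have "(\<Sum>i\<in>I. ?c i * cinner n (q i) f) = of_real (\<Sum>i\<in>I. (cmod (?c i))\<^sup>2)"
    unfolding of_real_sum complex_norm_square by (simp add: cnj_cinner)
  finally have "(\<Sum>s<n. (cmod (?r s))\<^sup>2) = (\<Sum>s<n. (cmod (f s))\<^sup>2) - (\<Sum>i\<in>I. (cmod (?c i))\<^sup>2)"
    unfolding cinner_self of_real_diff[symmetric] of_real_eq_iff .
  moreover have "0 \<le> (\<Sum>s<n. (cmod (?r s))\<^sup>2)" by (intro sum_nonneg) auto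
  ultimately show ?thesis by linarith
qed

text \<open>Gram-Schmidt that skips a vector lying in the span of the earlier ones. That
  \<open>I\<close> has at most \<open>k\<close> elements is the rank bound which enters Ky Fan's
  inequality.\<close>

lemma orthonormalization:
  obtains I q c where "I \<subseteq> {..<k}" "orthonormal_family n I q"
    "\<And>i s. i < k \<Longrightarrow> s < n \<Longrightarrow> x i s = (\<Sum>l\<in>I. c i l * q l s)"
proof (induction k arbitrary: thesis)
  case 0
  show ?case by (rule 0[of "{}"]) (auto simp: orthonormal_family_def)
next
  case (Suc k)
  obtain I q c where I: "I \<subseteq> {..<k}" and o: "orthonormal_family n I q"
    and x: "\<And>i s. i < k \<Longrightarrow> s < n \<Longrightarrow> x i s = (\<Sum>l\<in>I. c i l * q l s)"
    using Suc.IH by blast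
  have fin: "finite I" and kI: "k \<notin> I" using I finite_subset by auto
  \<comment> \<open>The part of \<open>x k\<close> orthogonal to the family found so far; its
    squared norm \<open>d\<close> vanishes exactly in the dependent case.\<close>
  define r where "r s = x k s - (\<Sum>l\<in>I. cinner n (x k) (q l) * q l s)" for s
  define d where "d = (\<Sum>s<n. (cmod (r s))\<^sup>2)"
  have r: "cinner n r (q j) = 0" if "j \<in> I" for j
    using orthonormal_family_remainder[OF fin o that] unfolding r_def .
  show ?case
  proof (cases "d = 0")
    case True
    then have r0: "r s = 0" if "s < n" for s
      using that unfolding d_def by (subst (asm) sum_nonneg_eq_0_iff) auto
    show ?thesis
    proof (rule Suc.prems[of I q "c(k := \<lambda>l. cinner n (x k) (q l))"])
      show "x i s = (\<Sum>l\<in>I. (c(k := \<lambda>l. cinner n (x k) (q l))) i l * q l s)" if "i < Suc k" "s < n" for i s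
        using that x[of i s] r0[of s] by (cases "i = k") (auto simp: r_def)
    qed (use I o in auto)
  next
    case False
    moreover have "d \<ge> 0" unfolding d_def by (intro sum_nonneg) auto
    ultimately have d: "d > 0" by simp
    define e where "e s = of_real (1 / sqrt d) * r s" for s
    have rr: "cinner n r r = of_real d" by (simp only: cinner_self d_def)
    have ee: "cinner n e e = 1"
      using d unfolding e_def[abs_def] cinner_smult_left cinner_smult_right rr by (simp flip: of_real_mult of_real_divide)
    have eq: "cinner n e (q j) = 0" if "j \<in> I" for j
      using r[OF that] unfolding e_def[abs_def] cinner_smult_left by simp
    have qe: "cinner n (q j) e = 0" if "j \<in> I" for j
      using eq[OF that] cnj_cinner[of n e "q j"] by simp
    \<comment> \<open>The new vector \<open>e\<close> gets index \<open>k\<close>: earlier vectors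
      have coefficient 0 there, and \<open>x k\<close> has its projections on the old family
      together with \<open>sqrt d\<close> along \<open>e\<close>.\<close>
    let ?c = "\<lambda>i l. if i = k then if l = k then of_real (sqrt d) else cinner n (x k) (q l)
      else if l = k then 0 else c i l"
    show ?thesis
    proof (rule Suc.prems[of "insert k I" "q(k := e)" ?c])
      show "orthonormal_family n (insert k I) (q(k := e))"
        using o kI eq qe ee unfolding orthonormal_family_def by auto
      fix i s assume k1: "i < Suc k" "s < n"
      have "(\<Sum>l\<in>I. ?c i l * (q(k := e)) l s) = (\<Sum>l\<in>I. (if i = k then cinner n (x k) (q l) else c i l) * q l s)"
        using kI by (intro sum.cong) auto
      then show "x i s = (\<Sum>l\<in>insert k I. ?c i l * (q(k := e)) l s)"
        using k1 x[of i s] fin kI d by (cases "i = k") (auto simp: r_def e_def)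
    qed (use I in auto)
  qed
qed

section \<open>Orthonormal bases and eigenbases of Hermitian matrices\<close>

definition orthonormal_basis :: "nat \<Rightarrow> (nat \<Rightarrow> nat \<Rightarrow> complex) \<Rightarrow> bool" where
  "orthonormal_basis n v \<longleftrightarrow> orthonormal_family n {..<n} v \<and> (\<forall>f. \<forall>s<n. f s = (\<Sum>l<n. cinner n f (v l) * v l s))"

lemma orthonormal_basis_expand:
  "orthonormal_basis n v \<Longrightarrow> s < n \<Longrightarrow> f s = (\<Sum>l<n. cinner n f (v l) * v l s)"
  by (simp only: orthonormal_basis_def)

definition mat_fun :: "complex mat \<Rightarrow> (nat \<Rightarrow> complex) \<Rightarrow> nat \<Rightarrow> complex" where
  "mat_fun B f p = (\<Sum>s<dim_col B. B $$ (p, s) * f s)"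

lemma mat_fun_sum: "mat_fun B (\<lambda>s. \<Sum>i\<in>I. c i * q i s) p = (\<Sum>i\<in>I. c i * mat_fun B (q i) p)"
  unfolding mat_fun_def sum_distrib_left by (subst sum.swap) (simp add: mult_ac)

lemma mat_fun_cong: "(\<And>s. s < dim_col B \<Longrightarrow> f s = g s) \<Longrightarrow> mat_fun B f p = mat_fun B g p"
  by (simp add: mat_fun_def)

text \<open>The basis consists of the columns of the diagonalizing unitary \<open>U\<close>.
  Orthonormality is U* U = 1 and the expansion of every vector is U U* = 1.\<close>

lemma hermitian_eigenbasis:
  fixes A :: "complex mat"
  assumes A: "A \<in> carrier_mat n n" "mat_adjoint A = A" "char_poly A = (\<Prod>e\<leftarrow>es. [:- e, 1:])"
  obtains v where "orthonormal_basis n v"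
    "\<And>i j. i < n \<Longrightarrow> j < n \<Longrightarrow> cinner n (mat_fun A (v i)) (v j) = (if i = j then es ! i else 0)"
proof -
  obtain U where U: "U \<in> carrier_mat n n" and UU: "mat_adjoint U * U = 1\<^sub>m n"
    and diag: "mat_adjoint U * A * U = mat_diag n (\<lambda>i. es ! i)"
    using hermitian_diagonalization[OF A] by blast
  have aU: "mat_adjoint U \<in> carrier_mat n n" using U by simp
  have UU': "U * mat_adjoint U = 1\<^sub>m n" using mat_mult_left_right_inverse[OF aU U UU] .
  define v where "v l s = U $$ (s, l)" for l s
  show thesis
  proof
    have on: "orthonormal_family n {..<n} v"
      unfolding orthonormal_family_def cinner_def
    proof (intro ballI)
      fix i j assume "i \<in> {..<n}" "j \<in> {..<n}"
      then have ij: "i < n" "j < n" by auto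
      have "(mat_adjoint U * U) $$ (j, i) = (\<Sum>s<n. v i s * cnj (v j s))"
        using U ij by (subst index_mult_mat_sum[of _ n n _ n]) (auto simp: v_def mult.commute)
      then show "(\<Sum>s<n. v i s * cnj (v j s)) = (if i = j then 1 else 0)" using ij by (auto simp: UU)
    qed
    have "f s = (\<Sum>l<n. cinner n f (v l) * v l s)" if s: "s < n" for f s
    proof -
      have *: "(\<Sum>l<n. v l s * cnj (v l t)) = (if s = t then 1 else 0)" if "t < n" for t
      proof -
        have "(U * mat_adjoint U) $$ (s, t) = (\<Sum>l<n. v l s * cnj (v l t))"
          using U s that by (subst index_mult_mat_sum[of _ n n _ n]) (auto simp: v_def)
        then show ?thesis using s that by (auto simp: UU')
      qed
      have "(\<Sum>l<n. cinner n f (v l) * v l s) = (\<Sum>t<n. f t * (\<Sum>l<n. v l s * cnj (v l t)))"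
        unfolding cinner_def sum_distrib_left sum_distrib_right by (subst sum.swap) (simp add: mult_ac)
      also have "\<dots> = (\<Sum>t<n. if t = s then f t else 0)" by (intro sum.cong) (auto simp: *)
      finally show ?thesis using s by simp
    qed
    with on show "orthonormal_basis n v" unfolding orthonormal_basis_def by blast
  next
    fix i j assume ij: "i < n" "j < n"
    have "(mat_adjoint U * (A * U)) $$ (j, i) = (\<Sum>s<n. cnj (v j s) * (A * U) $$ (s, i))"
      using U A aU ij by (subst index_mult_mat_sum[of _ n n _ n]) (auto simp: v_def)
    also have "\<dots> = cinner n (mat_fun A (v i)) (v j)" unfolding cinner_def
      using U A ij by (intro sum.cong refl, subst index_mult_mat_sum[of _ n n _ n])
        (auto simp: v_def mat_fun_def mult.commute)
    also have "mat_adjoint U * (A * U) = mat_diag n (\<lambda>i. es ! i)"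
      using U A aU by (simp add: diag assoc_mult_mat[of _ n n _ n _ n, symmetric])
    finally show "cinner n (mat_fun A (v i)) (v j) = (if i = j then es ! i else 0)"
      using ij by (auto simp: mat_diag_def)
  qed
qed

subsection \<open>Positive semidefinite block matrices and singular values\<close>

lemma positive_semidefinite_iff_cinner:
  assumes A: "A \<in> carrier_mat N N"
  shows "positive_semidefinite A \<longleftrightarrow> mat_adjoint A = A \<and> (\<forall>x. 0 \<le> cinner N (mat_fun A x) x)"
proof -
  have form: "(A *\<^sub>v v) \<bullet>c v = cinner N (mat_fun A (\<lambda>s. v $ s)) (\<lambda>s. v $ s)" if "v \<in> carrier_vec N" for v
    using A that by (auto simp: cinner_def mat_fun_def scalar_prod_def atLeast0LessThan intro!: sum.cong)
  have vec: "cinner N (mat_fun A x) x = (A *\<^sub>v vec N x) \<bullet>c vec N x" for x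
    unfolding form[OF vec_carrier] using A by (intro cinner_cong mat_fun_cong) auto
  have "(\<forall>v \<in> carrier_vec N. 0 \<le> (A *\<^sub>v v) \<bullet>c v) \<longleftrightarrow> (\<forall>x. 0 \<le> cinner N (mat_fun A x) x)"
    using form vec vec_carrier by metis
  then show ?thesis using A unfolding positive_semidefinite_def by auto
qed

text \<open>The spectral decomposition, with the square roots of the eigenvalues absorbed into the
  eigenvectors.\<close>

lemma positive_semidefinite_decomposition:
  assumes A: "A \<in> carrier_mat N N" and psd: "positive_semidefinite A"
  obtains x where "\<And>i j. i < N \<Longrightarrow> j < N \<Longrightarrow> A $$ (i, j) = (\<Sum>l<N. x l i * cnj (x l j))"
proof -
  obtain es where es: "char_poly A = (\<Prod>e\<leftarrow>es. [:- e, 1:])" using char_poly_factorized[OF A] by auto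
  have herm: "mat_adjoint A = A" and pos: "0 \<le> cinner N (mat_fun A x) x" for x
    using psd positive_semidefinite_iff_cinner[OF A] by auto
  obtain v where basis: "orthonormal_basis N v"
    and eig: "\<And>i j. i < N \<Longrightarrow> j < N \<Longrightarrow> cinner N (mat_fun A (v i)) (v j) = (if i = j then es ! i else 0)"
    using hermitian_eigenbasis[OF A herm es] by blast
  have Av: "mat_fun A (v l) s = es ! l * v l s" if "l < N" "s < N" for l s
  proof -
    have "mat_fun A (v l) s = (\<Sum>j<N. (if l = j then es ! l else 0) * v j s)"
      using orthonormal_basis_expand[OF basis that(2), of "mat_fun A (v l)"] eig[OF that(1)] by simp
    also have "\<dots> = (\<Sum>j<N. if j = l then es ! l * v l s else 0)" by (intro sum.cong) auto
    finally show ?thesis using that by simp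
  qed
  \<comment> \<open>Each eigenvalue is the value of the quadratic form at its unit eigenvector,
    hence real and nonnegative.\<close>
  have root: "of_real (sqrt (Re (es ! l))) * of_real (sqrt (Re (es ! l))) = es ! l" if "l < N" for l
    using pos[of "v l"] eig[OF that that] by (auto simp: less_eq_complex_def complex_eq_iff simp flip: of_real_mult)
  show thesis
  proof (rule that[of "\<lambda>l i. of_real (sqrt (Re (es ! l))) * v l i"])
    fix i j assume ij: "i < N" "j < N"
    \<comment> \<open>The \<open>j\<close>-th standard unit vector: the entry of \<open>A\<close> at
      \<open>(i, j)\<close> is coordinate \<open>i\<close> of \<open>A\<close> applied to
      \<open>u\<close>, which is then expanded in the eigenbasis.\<close>
    define u where "u s = (if s = j then 1 else 0 :: complex)" for s
    have u: "cinner N u (v l) = cnj (v l j)" for l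
    proof -
      have "cinner N u (v l) = (\<Sum>s<N. if s = j then cnj (v l j) else 0)"
        unfolding cinner_def u_def by (intro sum.cong) auto
      then show ?thesis using ij by simp
    qed
    have "mat_fun A u i = (\<Sum>s<N. if s = j then A $$ (i, j) else 0)"
      using A unfolding mat_fun_def u_def by (intro sum.cong) auto
    then have "A $$ (i, j) = mat_fun A u i" using ij by simp
    also have "\<dots> = mat_fun A (\<lambda>s. \<Sum>l<N. cinner N u (v l) * v l s) i" using A orthonormal_basis_expand[OF basis, of _ u] by (intro mat_fun_cong) simp
    also have "\<dots> = (\<Sum>l<N. cnj (v l j) * mat_fun A (v l) i)" by (simp only: mat_fun_sum u)
    also have "\<dots> = (\<Sum>l<N. of_real (sqrt (Re (es ! l))) * v l i * cnj (of_real (sqrt (Re (es ! l))) * v l j))"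
    proof (intro sum.cong refl)
      fix l assume "l \<in> {..<N}"
      then have l: "l < N" by simp
      let ?r = "complex_of_real (sqrt (Re (es ! l)))"
      have "cnj (v l j) * mat_fun A (v l) i = (?r * ?r) * (v l i * cnj (v l j))"
        unfolding root[OF l] Av[OF l ij(1)] by (simp only: mult_ac)
      also have "\<dots> = ?r * v l i * cnj (?r * v l j)" by (simp only: complex_cnj_mult complex_cnj_complex_of_real mult_ac)
      finally show "cnj (v l j) * mat_fun A (v l) i = ?r * v l i * cnj (?r * v l j)" .
    qed
    finally show "A $$ (i, j) = (\<Sum>l<N. of_real (sqrt (Re (es ! l))) * v l i * cnj (of_real (sqrt (Re (es ! l))) * v l j))" .
  qed
qed

lemma sum_block:
  fixes f :: "nat \<Rightarrow> 'a :: comm_monoid_add"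
  shows "(\<Sum>r<k * m. f r) = (\<Sum>i<k. \<Sum>p<m. f (i * m + p))"
proof (induction k)
  case (Suc k)
  have "{..<Suc k * m} = {..<k * m} \<union> {k * m..<k * m + m}" by auto
  then have "(\<Sum>r<Suc k * m. f r) = (\<Sum>r<k * m. f r) + (\<Sum>r=k * m..<k * m + m. f r)"
    by (simp add: sum.union_disjoint ivl_disj_int)
  also have "(\<Sum>r=k * m..<k * m + m. f r) = (\<Sum>p<m. f (k * m + p))"
    using sum.shift_bounds_nat_ivl[of f 0 "k * m" m] by (simp add: atLeast0LessThan add.commute)
  finally show ?case using Suc by simp
qed simp

lemma block_index_less: "i < k \<Longrightarrow> p < m \<Longrightarrow> i * m + p < k * (m :: nat)"
  by (metis add.commute add_less_cancel_left less_le_trans mult.commute mult_Suc_right mult_le_mono2 Suc_leI)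

text \<open>The flat index \<open>r\<close> corresponds to the pair of \<open>r div m\<close> and
  \<open>r mod m\<close>. This removes the assembled matrix from all later arguments, which work
  with the entries of single blocks.\<close>

lemma positive_semidefinite_block_matrix_iff:
  "positive_semidefinite (block_matrix k m A) \<longleftrightarrow>
    (\<forall>i<k. \<forall>j<k. \<forall>p<m. \<forall>q<m. A j i $$ (q, p) = cnj (A i j $$ (p, q))) \<and>
    (\<forall>x. 0 \<le> (\<Sum>i<k. \<Sum>p<m. (\<Sum>j<k. \<Sum>q<m. A i j $$ (p, q) * x j q) * cnj (x i p)))"
proof -
  let ?M = "block_matrix k m A"
  have M: "?M \<in> carrier_mat (k * m) (k * m)" by (simp add: block_matrix_def)
  have entry: "?M $$ (i * m + p, j * m + q) = A i j $$ (p, q)" if "i < k" "j < k" "p < m" "q < m" for i j p q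
    using that block_index_less[of i k p m] block_index_less[of j k q m] by (simp add: block_matrix_def)
  have herm: "mat_adjoint ?M = ?M \<longleftrightarrow> (\<forall>i<k. \<forall>j<k. \<forall>p<m. \<forall>q<m. A j i $$ (q, p) = cnj (A i j $$ (p, q)))"
  proof
    assume h: "mat_adjoint ?M = ?M"
    show "\<forall>i<k. \<forall>j<k. \<forall>p<m. \<forall>q<m. A j i $$ (q, p) = cnj (A i j $$ (p, q))"
    proof (intro allI impI)
      fix i j p q assume b: "i < k" "j < k" "p < m" "q < m"
      then show "A j i $$ (q, p) = cnj (A i j $$ (p, q))"
        using index_mat_adjoint[of "j * m + q" ?M "i * m + p"] M block_index_less[of i k p m] block_index_less[of j k q m]
        by (simp add: h entry)
    qed
  next
    assume h: "\<forall>i<k. \<forall>j<k. \<forall>p<m. \<forall>q<m. A j i $$ (q, p) = cnj (A i j $$ (p, q))"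
    show "mat_adjoint ?M = ?M"
    proof (rule eq_matI)
      fix r c assume "r < dim_row ?M" "c < dim_col ?M"
      then have rc: "r < k * m" "c < k * m" using M by auto
      then have "0 < m" by (cases m) auto
      with rc have "r div m < k" "c div m < k" "r mod m < m" "c mod m < m"
        by (auto simp: less_mult_imp_div_less)
      with h have "A (r div m) (c div m) $$ (r mod m, c mod m) = cnj (A (c div m) (r div m) $$ (c mod m, r mod m))"
        by blast
      then show "mat_adjoint ?M $$ (r, c) = ?M $$ (r, c)"
        using rc M by (simp add: block_matrix_def)
    qed (use M in auto)
  qed
  have form: "cinner (k * m) (mat_fun ?M y) y
     = (\<Sum>i<k. \<Sum>p<m. (\<Sum>j<k. \<Sum>q<m. A i j $$ (p, q) * y (j * m + q)) * cnj (y (i * m + p)))" for y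
    using M entry unfolding cinner_def mat_fun_def by (auto simp: sum_block intro!: sum.cong)
  have "(\<forall>y. 0 \<le> cinner (k * m) (mat_fun ?M y) y) \<longleftrightarrow>
    (\<forall>x. 0 \<le> (\<Sum>i<k. \<Sum>p<m. (\<Sum>j<k. \<Sum>q<m. A i j $$ (p, q) * x j q) * cnj (x i p)))"
    (is "?L \<longleftrightarrow> ?R")
  proof
    assume L: ?L
    show ?R
    proof
      fix x :: "nat \<Rightarrow> nat \<Rightarrow> complex"
      show "0 \<le> (\<Sum>i<k. \<Sum>p<m. (\<Sum>j<k. \<Sum>q<m. A i j $$ (p, q) * x j q) * cnj (x i p))"
        using L[rule_format, of "\<lambda>r. x (r div m) (r mod m)"] unfolding form by simp
    qed
  next
    assume R: ?R
    show ?L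
    proof
      fix y
      show "0 \<le> cinner (k * m) (mat_fun ?M y) y"
        using R[rule_format, of "\<lambda>i p. y (i * m + p)"] unfolding form by simp
    qed
  qed
  then show ?thesis unfolding positive_semidefinite_iff_cinner[OF M] herm by blast
qed

section \<open>Singular values and right singular vectors\<close>

lemma cinner_mat_fun_adjoint_mult:
  assumes B: "B \<in> carrier_mat m n"
  shows "cinner n (mat_fun (mat_adjoint B * B) f) g = cinner m (mat_fun B f) (mat_fun B g)"
proof -
  have "mat_fun (mat_adjoint B * B) f s = (\<Sum>p<m. cnj (B $$ (p, s)) * mat_fun B f p)" if "s < n" for s
  proof -
    have "mat_fun (mat_adjoint B * B) f s = (\<Sum>t<n. (\<Sum>p<m. cnj (B $$ (p, s)) * B $$ (p, t)) * f t)"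
      using B that unfolding mat_fun_def
      by (intro sum.cong) (auto simp: index_mult_mat_sum[of _ n m _ n] simp del: index_mult_mat(1))
    also have "\<dots> = (\<Sum>p<m. \<Sum>t<n. cnj (B $$ (p, s)) * B $$ (p, t) * f t)"
      unfolding sum_distrib_right by (rule sum.swap)
    finally show ?thesis using B by (simp add: mat_fun_def sum_distrib_left mult.assoc)
  qed
  then have "cinner n (mat_fun (mat_adjoint B * B) f) g = (\<Sum>s<n. \<Sum>p<m. cnj (B $$ (p, s)) * mat_fun B f p * cnj (g s))"
    by (simp add: cinner_def sum_distrib_right)
  also have "\<dots> = (\<Sum>p<m. \<Sum>s<n. cnj (B $$ (p, s)) * mat_fun B f p * cnj (g s))" by (rule sum.swap)
  also have "\<dots> = cinner m (mat_fun B f) (mat_fun B g)"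
    using B unfolding cinner_def mat_fun_def[of B g] by (simp add: sum_distrib_left mult_ac)
  finally show ?thesis .
qed

lemma proots_prod_linear: "proots (\<Prod>e\<leftarrow>es. [:- e, 1:]) = mset (es :: 'a :: idom list)"
proof (induction es)
  case (Cons e es)
  have "(\<Prod>e\<leftarrow>es. [:- e, 1:]) \<noteq> 0" by auto
  then show ?case using Cons by (simp add: proots_mult del: mult_pCons_left)
qed simp

text \<open>An eigenvalue of B* B is the squared norm of the image under \<open>B\<close> of a unit
  eigenvector, so squaring the root of its real part gives it back. The squared list is therefore a
  rearrangement of the roots of the characteristic polynomial.\<close>

lemma singular_value_list_facts:
  fixes B :: "complex mat"
  assumes B: "B \<in> carrier_mat m n"
  shows "length (singular_value_list B) = n"
    and "x \<in> set (singular_value_list B) \<Longrightarrow> 0 \<le> x"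
    and "char_poly (mat_adjoint B * B) = (\<Prod>e\<leftarrow>map (\<lambda>s. complex_of_real (s\<^sup>2)) (singular_value_list B). [:- e, 1:])"
proof -
  let ?T = "mat_adjoint B * B" and ?L = "singular_value_list B"
  have T: "?T \<in> carrier_mat n n" using mult_carrier_mat[OF mat_adjoint_carrier[OF B] B] .
  have herm: "mat_adjoint ?T = ?T" using B by (simp add: mat_adjoint_mult[of _ n m _ n])
  obtain es where es: "char_poly ?T = (\<Prod>e\<leftarrow>es. [:- e, 1:])" and len: "length es = n"
    using char_poly_factorized[OF T] by auto
  obtain v where "orthonormal_basis n v"
    and v: "\<And>i j. i < n \<Longrightarrow> j < n \<Longrightarrow> cinner n (mat_fun ?T (v i)) (v j) = (if i = j then es ! i else 0)"
    using hermitian_eigenbasis[OF T herm es] by blast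
  have real: "complex_of_real ((sqrt (Re z))\<^sup>2) = z" if z: "z \<in> set es" for z
  proof -
    obtain i where i: "i < n" "z = es ! i" using z len by (metis in_set_conv_nth)
    have "z = complex_of_real (\<Sum>p<m. (cmod (mat_fun B (v i) p))\<^sup>2)"
      using v[OF i(1) i(1)] i cinner_mat_fun_adjoint_mult[OF B] cinner_self by simp
    moreover have "0 \<le> (\<Sum>p<m. (cmod (mat_fun B (v i) p))\<^sup>2)" by (intro sum_nonneg) auto
    ultimately show ?thesis by (metis Re_complex_of_real real_sqrt_pow2)
  qed
  have "proots (char_poly ?T) = mset es"
    unfolding es by (rule proots_prod_linear)
  then have mL: "mset ?L = image_mset (\<lambda>z. sqrt (Re z)) (mset es)"
    unfolding singular_value_list_def by simp
  then have "size (mset ?L) = size (mset es)" by simp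
  then show "length ?L = n" using len by simp
  have "0 \<le> Re z" if "z \<in> set es" for z
    using arg_cong[OF real[OF that], of Re] by (metis Re_complex_of_real zero_le_power2)
  then show "0 \<le> x" if "x \<in> set ?L"
    using that mset_eq_setD[of ?L "map (\<lambda>z. sqrt (Re z)) es"] mL by auto
  have "mset (map (\<lambda>s. complex_of_real (s\<^sup>2)) ?L) = image_mset (\<lambda>z. complex_of_real ((sqrt (Re z))\<^sup>2)) (mset es)"
    unfolding mset_map mL by (simp add: image_mset.compositionality o_def)
  also have "\<dots> = image_mset id (mset es)"
    by (intro image_mset_cong) (simp only: real set_mset_mset id_apply)
  finally have eq: "mset (map (\<lambda>s. complex_of_real (s\<^sup>2)) ?L) = mset es" by simp
  have pl: "(\<Prod>e\<leftarrow>xs. [:- e, 1:]) = prod_mset (image_mset (\<lambda>e. [:- e, 1:]) (mset xs))" for xs :: "complex list"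
    by (metis mset_map prod_mset_prod_list)
  show "char_poly ?T = (\<Prod>e\<leftarrow>map (\<lambda>s. complex_of_real (s\<^sup>2)) ?L. [:- e, 1:])"
    unfolding es pl eq by (rule refl)
qed

lemma singular_value_list_antimono:
  assumes B: "B \<in> carrier_mat m n" and ij: "i \<le> j" "j < n"
  shows "(singular_value_list B ! j)\<^sup>2 \<le> (singular_value_list B ! i)\<^sup>2"
proof (rule power_mono)
  have "sorted (rev (singular_value_list B))" by (simp add: singular_value_list_def)
  then show "singular_value_list B ! j \<le> singular_value_list B ! i"
    using sorted_rev_nth_mono ij singular_value_list_facts(1)[OF B] by blast
  show "0 \<le> singular_value_list B ! j"
    using ij singular_value_list_facts(1,2)[OF B] by simp
qed

text \<open>As \<open>k \<le> m\<close>, of the cutoff of the singular values at \<open>min m n\<close> only the cutoff at \<open>n\<close> matters,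
  and that is the length of the list: no statement about the rank of \<open>B\<close> is needed.\<close>

lemma sum_singular_values:
  assumes B: "B \<in> carrier_mat m n" and "k \<le> m"
  shows "(\<Sum>j = 1..k. (singular_value B j)\<^sup>2) = (\<Sum>j<min k n. (singular_value_list B ! j)\<^sup>2)"
proof -
  have "(\<Sum>j = 1..k. (singular_value B j)\<^sup>2) = (\<Sum>j<k. (singular_value B (Suc j))\<^sup>2)"
    by (rule sum.reindex_bij_witness[of _ Suc "\<lambda>j. j - 1"]) auto
  also have "\<dots> = (\<Sum>j\<in>{..<k}. if j < n then (singular_value_list B ! j)\<^sup>2 else 0)"
    using assms by (intro sum.cong) (auto simp: singular_value_def)
  also have "\<dots> = (\<Sum>j\<in>{..<k} \<inter> {j. j < n}. (singular_value_list B ! j)\<^sup>2)"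
    by (subst sum.inter_restrict) auto
  also have "{..<k} \<inter> {j. j < n} = {..<min k n}" by auto
  finally show ?thesis .
qed

text \<open>Eigenvectors of B* B have orthogonal images under \<open>B\<close>. The factorization is
  taken in the order of \<open>singular_value_list B\<close>, so that \<open>v 0\<close> belongs to
  the largest singular value.\<close>

lemma right_singular_basis:
  assumes B: "B \<in> carrier_mat m n"
  obtains v where "orthonormal_basis n v"
    "\<And>i j. i < n \<Longrightarrow> j < n \<Longrightarrow>
      cinner m (mat_fun B (v i)) (mat_fun B (v j)) = (if i = j then of_real ((singular_value_list B ! i)\<^sup>2) else 0)"
proof -
  let ?T = "mat_adjoint B * B"
  have T: "?T \<in> carrier_mat n n" using mult_carrier_mat[OF mat_adjoint_carrier[OF B] B] .
  have herm: "mat_adjoint ?T = ?T" using B by (simp add: mat_adjoint_mult[of _ n m _ n])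
  from hermitian_eigenbasis[OF T herm singular_value_list_facts(3)[OF B]]
  obtain v where v: "orthonormal_basis n v"
    "\<And>i j. i < n \<Longrightarrow> j < n \<Longrightarrow> cinner n (mat_fun ?T (v i)) (v j)
      = (if i = j then map (\<lambda>s. complex_of_real (s\<^sup>2)) (singular_value_list B) ! i else 0)" by blast
  show thesis
  proof (rule that[OF v(1)])
    fix i j assume ij: "i < n" "j < n"
    show "cinner m (mat_fun B (v i)) (mat_fun B (v j)) = (if i = j then of_real ((singular_value_list B ! i)\<^sup>2) else 0)"
      using v(2)[OF ij] ij singular_value_list_facts(1)[OF B] unfolding cinner_mat_fun_adjoint_mult[OF B] by simp
  qed
qed

subsection \<open>The map and its quadratic forms\<close>

lemma Phi_minus_carrier [simp]:
  "B \<in> carrier_mat m n \<Longrightarrow> Phi_minus \<alpha> B X \<in> carrier_mat m m"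
  unfolding Phi_minus_def by auto

lemma index_Phi_minus:
  assumes "B \<in> carrier_mat m n" "X \<in> carrier_mat n n" "p < m" "q < m"
  shows "Phi_minus \<alpha> B X $$ (p, q) = (if p = q then of_real \<alpha> * (\<Sum>s<n. X $$ (s, s)) else 0)
    - (\<Sum>s<n. \<Sum>t<n. B $$ (p, s) * X $$ (s, t) * cnj (B $$ (q, t)))"
proof -
  have "(B * X * mat_adjoint B) $$ (p, q) = (\<Sum>t<n. (\<Sum>s<n. B $$ (p, s) * X $$ (s, t)) * cnj (B $$ (q, t)))"
    using assms by (subst index_mult_mat_sum[of _ m n _ m])
      (auto simp: index_mult_mat_sum[of _ m n _ n] simp del: index_mult_mat(1) intro!: sum.cong)
  also have "\<dots> = (\<Sum>s<n. \<Sum>t<n. B $$ (p, s) * X $$ (s, t) * cnj (B $$ (q, t)))"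
    unfolding sum_distrib_right by (rule sum.swap)
  finally have "(B * X * mat_adjoint B) $$ (p, q) = (\<Sum>s<n. \<Sum>t<n. B $$ (p, s) * X $$ (s, t) * cnj (B $$ (q, t)))" .
  moreover have "dim_row X = n" "dim_row B = m" using assms by auto
  moreover have "Phi_minus \<alpha> B X $$ (p, q)
    = (of_real \<alpha> * mat_trace X) * (1\<^sub>m m) $$ (p, q) - (B * X * mat_adjoint B) $$ (p, q)"
    unfolding Phi_minus_def using assms by (simp del: index_mult_mat(1))
  ultimately show ?thesis using assms(3,4) by (simp add: mat_trace_def)
qed

lemma linear_Phi_minus:
  assumes B: "B \<in> carrier_mat m n"
  shows "linear_mat_map n m (Phi_minus \<alpha> B)"
  unfolding linear_mat_map_def
proof (intro conjI ballI allI)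
  note c = Phi_minus_carrier[OF B]
  fix X :: "complex mat" assume X: "X \<in> carrier_mat n n"
  show "Phi_minus \<alpha> B X \<in> carrier_mat m m" by (rule c)
  {
    fix Y :: "complex mat" assume Y: "Y \<in> carrier_mat n n"
    show "Phi_minus \<alpha> B (X + Y) = Phi_minus \<alpha> B X + Phi_minus \<alpha> B Y"
    proof (rule eq_matI)
      fix p q assume "p < dim_row (Phi_minus \<alpha> B X + Phi_minus \<alpha> B Y)" "q < dim_col (Phi_minus \<alpha> B X + Phi_minus \<alpha> B Y)"
      then have pq: "p < m" "q < m" using c[of \<alpha> Y] by auto
      have "(\<Sum>s<n. (X + Y) $$ (s, s)) = (\<Sum>s<n. X $$ (s, s)) + (\<Sum>s<n. Y $$ (s, s))"
        unfolding sum.distrib[symmetric] using X Y by (intro sum.cong refl) simp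
      moreover have "(\<Sum>s<n. \<Sum>t<n. B $$ (p, s) * (X + Y) $$ (s, t) * cnj (B $$ (q, t)))
        = (\<Sum>s<n. \<Sum>t<n. B $$ (p, s) * X $$ (s, t) * cnj (B $$ (q, t)))
          + (\<Sum>s<n. \<Sum>t<n. B $$ (p, s) * Y $$ (s, t) * cnj (B $$ (q, t)))"
        unfolding sum.distrib[symmetric] using X Y by (intro sum.cong refl) (simp add: algebra_simps)
      moreover have "(Phi_minus \<alpha> B X + Phi_minus \<alpha> B Y) $$ (p, q) = Phi_minus \<alpha> B X $$ (p, q) + Phi_minus \<alpha> B Y $$ (p, q)"
        using pq c[of \<alpha> X] c[of \<alpha> Y] by simp
      ultimately show "Phi_minus \<alpha> B (X + Y) $$ (p, q) = (Phi_minus \<alpha> B X + Phi_minus \<alpha> B Y) $$ (p, q)"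
        unfolding index_Phi_minus[OF B X pq] index_Phi_minus[OF B Y pq] index_Phi_minus[OF B add_carrier_mat[OF Y] pq]
        by (simp add: distrib_left)
    qed (use c[of \<alpha> "X + Y"] c[of \<alpha> Y] in auto)
  }
  fix z
  show "Phi_minus \<alpha> B (z \<cdot>\<^sub>m X) = z \<cdot>\<^sub>m Phi_minus \<alpha> B X"
  proof (rule eq_matI)
    fix p q assume "p < dim_row (z \<cdot>\<^sub>m Phi_minus \<alpha> B X)" "q < dim_col (z \<cdot>\<^sub>m Phi_minus \<alpha> B X)"
    then have pq: "p < m" "q < m" using c[of \<alpha> X] by auto
    have "(\<Sum>s<n. (z \<cdot>\<^sub>m X) $$ (s, s)) = z * (\<Sum>s<n. X $$ (s, s))"
      using X by (simp add: sum_distrib_left)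
    moreover have "(\<Sum>s<n. \<Sum>t<n. B $$ (p, s) * (z \<cdot>\<^sub>m X) $$ (s, t) * cnj (B $$ (q, t)))
      = z * (\<Sum>s<n. \<Sum>t<n. B $$ (p, s) * X $$ (s, t) * cnj (B $$ (q, t)))"
      unfolding sum_distrib_left using X by (intro sum.cong refl) simp
    moreover have "(z \<cdot>\<^sub>m Phi_minus \<alpha> B X) $$ (p, q) = z * Phi_minus \<alpha> B X $$ (p, q)"
      using pq c[of \<alpha> X] by simp
    ultimately show "Phi_minus \<alpha> B (z \<cdot>\<^sub>m X) $$ (p, q) = (z \<cdot>\<^sub>m Phi_minus \<alpha> B X) $$ (p, q)"
      unfolding index_Phi_minus[OF B X pq] index_Phi_minus[OF B smult_carrier_mat[OF X] pq]
      by (simp add: right_diff_distrib)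
  qed (use c[of \<alpha> "z \<cdot>\<^sub>m X"] c[of \<alpha> X] in auto)
qed

text \<open>For a rank one argument f g* the trace is the inner product of \<open>f\<close> and
  \<open>g\<close>, and conjugation by \<open>B\<close> gives the outer product of
  \<open>B f\<close> and \<open>B g\<close>; the general case sums over \<open>l\<close>.\<close>

lemma index_Phi_minus_gram:
  assumes B: "B \<in> carrier_mat m n" and X: "X \<in> carrier_mat n n" and pq: "p < m" "q < m"
    and gram: "\<And>s t. s < n \<Longrightarrow> t < n \<Longrightarrow> X $$ (s, t) = (\<Sum>l<N. f l s * cnj (g l t))"
  shows "Phi_minus \<alpha> B X $$ (p, q) = (\<Sum>l<N.
    (if p = q then of_real \<alpha> * cinner n (f l) (g l) else 0) - mat_fun B (f l) p * cnj (mat_fun B (g l) q))"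
proof -
  have "(\<Sum>s<n. X $$ (s, s)) = (\<Sum>s<n. \<Sum>l<N. f l s * cnj (g l s))" using gram by simp
  also have "\<dots> = (\<Sum>l<N. cinner n (f l) (g l))" unfolding cinner_def by (rule sum.swap)
  finally have tr: "(\<Sum>s<n. X $$ (s, s)) = (\<Sum>l<N. cinner n (f l) (g l))" .
  have "(\<Sum>s<n. \<Sum>t<n. B $$ (p, s) * X $$ (s, t) * cnj (B $$ (q, t)))
      = (\<Sum>s<n. \<Sum>t<n. \<Sum>l<N. B $$ (p, s) * f l s * cnj (B $$ (q, t) * g l t))"
    by (intro sum.cong refl) (simp add: gram sum_distrib_left sum_distrib_right mult_ac)
  also have "\<dots> = (\<Sum>s<n. \<Sum>l<N. \<Sum>t<n. B $$ (p, s) * f l s * cnj (B $$ (q, t) * g l t))"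
    by (intro sum.cong refl sum.swap)
  also have "\<dots> = (\<Sum>l<N. \<Sum>s<n. \<Sum>t<n. B $$ (p, s) * f l s * cnj (B $$ (q, t) * g l t))"
    by (rule sum.swap)
  also have "\<dots> = (\<Sum>l<N. mat_fun B (f l) p * cnj (mat_fun B (g l) q))"
    using B by (simp add: mat_fun_def sum_product)
  finally show ?thesis
    unfolding index_Phi_minus[OF B X pq] tr by (simp add: sum_subtractf sum_distrib_left)
qed

text \<open>The left side is the quadratic form at \<open>w\<close> of the image of the block matrix
  with blocks x_i x_j*. On the right, the sum over \<open>i\<close> in the first term is the entry
  \<open>(s, p)\<close> of Y, the sum of the x_i w_i*. So the two terms are \<alpha> times the
  squared Frobenius norm of Y and the squared modulus of tr (B Y).\<close>

lemma Phi_minus_form: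
  "(\<Sum>i<k. \<Sum>p<m. (\<Sum>j<k. \<Sum>q<m.
      ((if p = q then of_real \<alpha> * cinner n (x i) (x j) else 0) - mat_fun B (x i) p * cnj (mat_fun B (x j) q)) * w j q) * cnj (w i p))
    = of_real (\<alpha> * (\<Sum>p<m. \<Sum>s<n. (cmod (\<Sum>i<k. cnj (w i p) * x i s))\<^sup>2)
        - (cmod (\<Sum>i<k. cinner m (mat_fun B (x i)) (w i)))\<^sup>2)"
proof -
  let ?Z = "\<Sum>i<k. cinner m (mat_fun B (x i)) (w i)"
  let ?M = "\<lambda>p s. \<Sum>i<k. cnj (w i p) * x i s"
  have inner: "(\<Sum>j<k. \<Sum>q<m.
      ((if p = q then of_real \<alpha> * cinner n (x i) (x j) else 0) - mat_fun B (x i) p * cnj (mat_fun B (x j) q)) * w j q)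
      = of_real \<alpha> * cinner n (x i) (?M p) - mat_fun B (x i) p * cnj ?Z" if "p < m" for i p
  proof -
    have "(\<Sum>q<m. ((if p = q then of_real \<alpha> * cinner n (x i) (x j) else 0) - mat_fun B (x i) p * cnj (mat_fun B (x j) q)) * w j q)
        = of_real \<alpha> * (w j p * cinner n (x i) (x j)) - mat_fun B (x i) p * cnj (cinner m (mat_fun B (x j)) (w j))" for j
    proof -
      have "(\<Sum>q<m. (if p = q then of_real \<alpha> * cinner n (x i) (x j) else 0) * w j q)
        = (\<Sum>q<m. if q = p then of_real \<alpha> * cinner n (x i) (x j) * w j p else 0)"
        by (intro sum.cong) auto
      then show ?thesis using that unfolding left_diff_distrib sum_subtractf
        by (simp add: cinner_def[of m] sum_distrib_left mult_ac)
    qed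
    moreover have "cinner n (x i) (?M p) = (\<Sum>j<k. w j p * cinner n (x i) (x j))"
    proof -
      have "cinner n (x i) (?M p) = cnj (\<Sum>j<k. cnj (w j p) * cinner n (x j) (x i))"
        by (simp only: cinner_sum_left[symmetric] cnj_cinner)
      then show ?thesis by (simp add: cnj_cinner)
    qed
    ultimately show ?thesis by (simp add: sum_subtractf sum_distrib_left)
  qed
  have "(\<Sum>i<k. \<Sum>p<m. of_real \<alpha> * cinner n (x i) (?M p) * cnj (w i p))
      = (\<Sum>p<m. \<Sum>i<k. of_real \<alpha> * cinner n (x i) (?M p) * cnj (w i p))" by (rule sum.swap)
  also have "\<dots> = (\<Sum>p<m. of_real \<alpha> * cinner n (?M p) (?M p))"
    unfolding cinner_sum_left by (simp add: sum_distrib_left mult_ac)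
  also have "\<dots> = of_real (\<alpha> * (\<Sum>p<m. \<Sum>s<n. (cmod (?M p s))\<^sup>2))"
    unfolding cinner_self by (simp add: sum_distrib_left)
  finally have 1: "(\<Sum>i<k. \<Sum>p<m. of_real \<alpha> * cinner n (x i) (?M p) * cnj (w i p))
      = of_real (\<alpha> * (\<Sum>p<m. \<Sum>s<n. (cmod (?M p s))\<^sup>2))" .
  have "(\<Sum>i<k. \<Sum>p<m. mat_fun B (x i) p * z * cnj (w i p)) = ?Z * z" for z
    unfolding cinner_def[of m] by (simp add: sum_distrib_left mult_ac)
  then have 2: "(\<Sum>i<k. \<Sum>p<m. mat_fun B (x i) p * cnj ?Z * cnj (w i p)) = of_real ((cmod ?Z)\<^sup>2)"
    by (simp only: complex_norm_square)
  have "(\<Sum>i<k. \<Sum>p<m. (\<Sum>j<k. \<Sum>q<m.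
      ((if p = q then of_real \<alpha> * cinner n (x i) (x j) else 0) - mat_fun B (x i) p * cnj (mat_fun B (x j) q)) * w j q) * cnj (w i p))
    = (\<Sum>i<k. \<Sum>p<m. of_real \<alpha> * cinner n (x i) (?M p) * cnj (w i p))
      - (\<Sum>i<k. \<Sum>p<m. mat_fun B (x i) p * cnj ?Z * cnj (w i p))"
    unfolding sum_subtractf[symmetric] left_diff_distrib[symmetric] by (intro sum.cong refl) (simp only: inner lessThan_iff)
  then show ?thesis unfolding 1 2 of_real_diff .
qed

text \<open>With the block indices swapped, \<open>w\<close> enters unconjugated:
  \<open>\<Sum>i<k. w i q * x i s\<close> is the entry \<open>(s, q)\<close> of U. The subtracted
  term pairs the entry \<open>(p, q)\<close> of N = B U with the conjugate of its entry
  \<open>(q, p)\<close>, so it is no longer a single square.\<close>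

lemma Phi_minus_form_transpose:
  "(\<Sum>i<k. \<Sum>p<m. (\<Sum>j<k. \<Sum>q<m.
      ((if p = q then of_real \<alpha> * cinner n (x j) (x i) else 0) - mat_fun B (x j) p * cnj (mat_fun B (x i) q)) * w j q) * cnj (w i p))
    = of_real (\<alpha> * (\<Sum>p<m. \<Sum>s<n. (cmod (\<Sum>i<k. w i p * x i s))\<^sup>2))
      - (\<Sum>p<m. \<Sum>q<m. mat_fun B (\<lambda>s. \<Sum>i<k. w i q * x i s) p * cnj (mat_fun B (\<lambda>s. \<Sum>i<k. w i p * x i s) q))"
proof -
  let ?Y = "\<lambda>p s. \<Sum>i<k. w i p * x i s"
  have inner: "(\<Sum>j<k. \<Sum>q<m.
      ((if p = q then of_real \<alpha> * cinner n (x j) (x i) else 0) - mat_fun B (x j) p * cnj (mat_fun B (x i) q)) * w j q)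
      = of_real \<alpha> * cinner n (?Y p) (x i) - (\<Sum>q<m. mat_fun B (?Y q) p * cnj (mat_fun B (x i) q))" if "p < m" for i p
  proof -
    have "(\<Sum>q<m. ((if p = q then of_real \<alpha> * cinner n (x j) (x i) else 0) - mat_fun B (x j) p * cnj (mat_fun B (x i) q)) * w j q)
        = of_real \<alpha> * (w j p * cinner n (x j) (x i)) - (\<Sum>q<m. w j q * mat_fun B (x j) p * cnj (mat_fun B (x i) q))" for j
    proof -
      have "(\<Sum>q<m. (if p = q then of_real \<alpha> * cinner n (x j) (x i) else 0) * w j q)
        = (\<Sum>q<m. if q = p then of_real \<alpha> * cinner n (x j) (x i) * w j p else 0)"
        by (intro sum.cong) auto
      then show ?thesis using that unfolding left_diff_distrib sum_subtractf
        by (simp add: mult_ac)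
    qed
    moreover have "(\<Sum>q<m. mat_fun B (?Y q) p * cnj (mat_fun B (x i) q)) = (\<Sum>j<k. \<Sum>q<m. w j q * mat_fun B (x j) p * cnj (mat_fun B (x i) q))"
      unfolding mat_fun_sum sum_distrib_right by (rule sum.swap)
    ultimately show ?thesis unfolding cinner_sum_left by (simp add: sum_subtractf sum_distrib_left)
  qed
  have "(\<Sum>i<k. \<Sum>p<m. of_real \<alpha> * cinner n (?Y p) (x i) * cnj (w i p))
      = (\<Sum>p<m. \<Sum>i<k. of_real \<alpha> * cinner n (?Y p) (x i) * cnj (w i p))" by (rule sum.swap)
  also have "\<dots> = (\<Sum>p<m. of_real \<alpha> * cinner n (?Y p) (?Y p))"
  proof (intro sum.cong refl)
    fix p
    have "cinner n (?Y p) (?Y p) = cnj (\<Sum>i<k. w i p * cinner n (x i) (?Y p))"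
      by (simp only: cinner_sum_left[symmetric] cnj_cinner)
    also have "\<dots> = (\<Sum>i<k. cnj (w i p) * cinner n (?Y p) (x i))" by (simp add: cnj_cinner)
    finally show "(\<Sum>i<k. of_real \<alpha> * cinner n (?Y p) (x i) * cnj (w i p)) = of_real \<alpha> * cinner n (?Y p) (?Y p)"
      by (simp only: sum_distrib_left mult_ac)
  qed
  also have "\<dots> = of_real (\<alpha> * (\<Sum>p<m. \<Sum>s<n. (cmod (?Y p s))\<^sup>2))"
    unfolding cinner_self by (simp add: sum_distrib_left)
  finally have 1: "(\<Sum>i<k. \<Sum>p<m. of_real \<alpha> * cinner n (?Y p) (x i) * cnj (w i p))
      = of_real (\<alpha> * (\<Sum>p<m. \<Sum>s<n. (cmod (?Y p s))\<^sup>2))" .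
  have "(\<Sum>i<k. \<Sum>p<m. (\<Sum>q<m. mat_fun B (?Y q) p * cnj (mat_fun B (x i) q)) * cnj (w i p))
    = (\<Sum>p<m. \<Sum>i<k. \<Sum>q<m. mat_fun B (?Y q) p * cnj (mat_fun B (x i) q) * cnj (w i p))"
    unfolding sum_distrib_right by (rule sum.swap)
  also have "\<dots> = (\<Sum>p<m. \<Sum>q<m. \<Sum>i<k. mat_fun B (?Y q) p * cnj (mat_fun B (x i) q) * cnj (w i p))"
    by (intro sum.cong refl sum.swap)
  also have "\<dots> = (\<Sum>p<m. \<Sum>q<m. mat_fun B (?Y q) p * cnj (mat_fun B (?Y p) q))"
    unfolding mat_fun_sum[of B "\<lambda>i. w i p" for p] by (simp only: cnj_sum complex_cnj_mult sum_distrib_left mult_ac)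
  finally have 2: "(\<Sum>i<k. \<Sum>p<m. (\<Sum>q<m. mat_fun B (?Y q) p * cnj (mat_fun B (x i) q)) * cnj (w i p))
    = (\<Sum>p<m. \<Sum>q<m. mat_fun B (?Y q) p * cnj (mat_fun B (?Y p) q))" .
  have "(\<Sum>i<k. \<Sum>p<m. (\<Sum>j<k. \<Sum>q<m.
      ((if p = q then of_real \<alpha> * cinner n (x j) (x i) else 0) - mat_fun B (x j) p * cnj (mat_fun B (x i) q)) * w j q) * cnj (w i p))
    = (\<Sum>i<k. \<Sum>p<m. of_real \<alpha> * cinner n (?Y p) (x i) * cnj (w i p))
      - (\<Sum>i<k. \<Sum>p<m. (\<Sum>q<m. mat_fun B (?Y q) p * cnj (mat_fun B (x i) q)) * cnj (w i p))"
    unfolding sum_subtractf[symmetric] left_diff_distrib[symmetric] by (intro sum.cong refl) (simp only: inner lessThan_iff)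
  then show ?thesis unfolding 1 2 .
qed

subsection \<open>Ky Fan's inequality\<close>

lemma parseval:
  assumes "orthonormal_basis n v"
  shows "(\<Sum>s<n. (cmod (f s))\<^sup>2) = (\<Sum>l<n. (cmod (cinner n f (v l)))\<^sup>2)"
proof -
  have "(\<Sum>s<n. (cmod (f s))\<^sup>2) = (\<Sum>s<n. (cmod (\<Sum>l<n. cinner n f (v l) * v l s))\<^sup>2)"
    using orthonormal_basis_expand[OF assms, of _ f] by simp
  also have "\<dots> = (\<Sum>l<n. 1 * (cmod (cinner n f (v l)))\<^sup>2)"
    using assms by (intro cinner_sum_sum) (auto simp: orthonormal_basis_def orthonormal_family_def)
  finally show ?thesis by simp
qed

text \<open>The weights \<open>t\<close> are compared with the indicator \<open>?d\<close> of the
  first \<open>k\<close> indices: \<open>a l - c\<close> and \<open>t l - ?d l\<close> never have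
  the same strict sign, because \<open>a\<close> decreases through the threshold \<open>c\<close> at
  index \<open>k\<close>. The bound on the total of \<open>t\<close> disposes of the term with
  \<open>c\<close>.\<close>

lemma weighted_sum_le_initial_sum:
  fixes a t :: "nat \<Rightarrow> real"
  assumes anti: "\<And>i j. i \<le> j \<Longrightarrow> j < n \<Longrightarrow> a j \<le> a i" and nonneg: "\<And>l. l < n \<Longrightarrow> 0 \<le> a l"
    and t: "\<And>l. l < n \<Longrightarrow> 0 \<le> t l" "\<And>l. l < n \<Longrightarrow> t l \<le> 1" and sum_t: "(\<Sum>l<n. t l) \<le> real k"
  shows "(\<Sum>l<n. a l * t l) \<le> (\<Sum>l<min k n. a l)"
proof -
  \<comment> \<open>For \<open>k \<ge> n\<close> the initial segment is everything; threshold 0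
    makes the correction term vanish.\<close>
  define c where "c = (if k < n then a k else 0)"
  let ?d = "\<lambda>l. if l < k then 1 else (0 :: real)"
  have pt: "(a l - c) * (t l - ?d l) \<le> 0" if "l < n" for l
    using that t[OF that] nonneg[OF that] anti[of l k] anti[of k l]
    by (cases "l < k") (auto simp: c_def mult_nonneg_nonpos mult_nonpos_nonneg)
  have d: "(\<Sum>l<n. f l * ?d l) = (\<Sum>l<min k n. f l)" for f
  proof -
    have "(\<Sum>l<n. f l * ?d l) = (\<Sum>l\<in>{..<n}. if l \<in> {..<k} then f l else 0)"
      by (intro sum.cong) auto
    also have "\<dots> = (\<Sum>l\<in>{..<n} \<inter> {..<k}. f l)" by (subst sum.inter_restrict) auto
    also have "{..<n} \<inter> {..<k} = {..<min k n}" by auto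
    finally show ?thesis .
  qed
  have "0 \<ge> (\<Sum>l<n. (a l - c) * (t l - ?d l))" by (intro sum_nonpos) (use pt in auto)
  also have "(\<Sum>l<n. (a l - c) * (t l - ?d l)) = (\<Sum>l<n. a l * t l - a l * ?d l - (c * t l - c * ?d l))"
    by (intro sum.cong refl) (simp add: algebra_simps)
  also have "\<dots> = (\<Sum>l<n. a l * t l) - (\<Sum>l<n. a l * ?d l) - (c * (\<Sum>l<n. t l) - (\<Sum>l<n. c * ?d l))"
    by (simp only: sum_subtractf sum_distrib_left)
  finally have "(\<Sum>l<n. a l * t l) \<le> (\<Sum>l<min k n. a l) + c * ((\<Sum>l<n. t l) - real (min k n))"
    unfolding d by (simp add: algebra_simps)
  moreover have "c * ((\<Sum>l<n. t l) - real (min k n)) \<le> 0"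
    using sum_t nonneg[of k] by (auto simp: c_def mult_nonneg_nonpos)
  ultimately show ?thesis by linarith
qed

text \<open>Expand \<open>f\<close> in the basis and apply Pythagoras to the images
  \<open>mat_fun B (v l)\<close>, which are orthogonal with squared norms
  \<open>a l\<close>.\<close>

lemma mat_fun_norm_singular_basis:
  assumes B: "B \<in> carrier_mat m n" and basis: "orthonormal_basis n v"
    and sv: "\<And>i j. i < n \<Longrightarrow> j < n \<Longrightarrow> cinner m (mat_fun B (v i)) (mat_fun B (v j)) = (if i = j then of_real (a i) else 0)"
  shows "(\<Sum>p<m. (cmod (mat_fun B f p))\<^sup>2) = (\<Sum>l<n. a l * (cmod (cinner n f (v l)))\<^sup>2)"
proof -
  have "mat_fun B f p = (\<Sum>l<n. cinner n f (v l) * mat_fun B (v l) p)" for p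
    unfolding mat_fun_sum[symmetric] using orthonormal_basis_expand[OF basis, of _ f] B by (intro mat_fun_cong) simp
  then have "(\<Sum>p<m. (cmod (mat_fun B f p))\<^sup>2) = (\<Sum>p<m. (cmod (\<Sum>l<n. cinner n f (v l) * mat_fun B (v l) p))\<^sup>2)" by simp
  also have "\<dots> = (\<Sum>l<n. a l * (cmod (cinner n f (v l)))\<^sup>2)"
    by (rule cinner_sum_sum) (use sv in auto)
  finally show ?thesis .
qed

text \<open>In the basis of right singular vectors the left side weights each squared singular value
  by \<open>t l\<close>, the squared norm of the projection of \<open>v l\<close> onto the span of
  the \<open>q i\<close>. Bessel gives \<open>t l \<le> 1\<close> and Parseval gives total weight
  \<open>card I\<close>.\<close>

lemma ky_fan_inequality:
  assumes B: "B \<in> carrier_mat m n" and I: "finite I" "card I \<le> k" and q: "orthonormal_family n I q"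
  shows "(\<Sum>i\<in>I. \<Sum>p<m. (cmod (mat_fun B (q i) p))\<^sup>2) \<le> (\<Sum>l<min k n. (singular_value_list B ! l)\<^sup>2)"
proof -
  let ?a = "\<lambda>l. (singular_value_list B ! l)\<^sup>2"
  obtain v where v: "orthonormal_basis n v"
    "\<And>i j. i < n \<Longrightarrow> j < n \<Longrightarrow> cinner m (mat_fun B (v i)) (mat_fun B (v j)) = (if i = j then of_real (?a i) else 0)"
    using right_singular_basis[OF B] by blast
  define t where "t l = (\<Sum>i\<in>I. (cmod (cinner n (q i) (v l)))\<^sup>2)" for l
  have norm1: "(\<Sum>s<n. (cmod (f s))\<^sup>2) = 1" if "cinner n f f = 1" for f
    using that unfolding cinner_self by (metis of_real_eq_1_iff)
  have "(\<Sum>i\<in>I. \<Sum>p<m. (cmod (mat_fun B (q i) p))\<^sup>2) = (\<Sum>i\<in>I. \<Sum>l<n. ?a l * (cmod (cinner n (q i) (v l)))\<^sup>2)"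
    by (intro sum.cong refl mat_fun_norm_singular_basis[OF B v(1)]) (rule v(2))
  also have "\<dots> = (\<Sum>l<n. ?a l * t l)" unfolding t_def sum_distrib_left by (rule sum.swap)
  also have "\<dots> \<le> (\<Sum>l<min k n. ?a l)"
  proof (rule weighted_sum_le_initial_sum)
    show "?a j \<le> ?a i" if "i \<le> j" "j < n" for i j using singular_value_list_antimono[OF B that] .
    show "0 \<le> t l" for l unfolding t_def by (intro sum_nonneg) auto
    show "t l \<le> 1" if "l < n" for l
    proof -
      have "t l = (\<Sum>i\<in>I. (cmod (cinner n (v l) (q i)))\<^sup>2)"
        unfolding t_def by (intro sum.cong refl) (metis cnj_cinner complex_mod_cnj)
      also have "\<dots> \<le> (\<Sum>s<n. (cmod (v l s))\<^sup>2)" by (rule bessel_inequality[OF I(1) q])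
      also have "\<dots> = 1" using v(1) that by (intro norm1) (auto simp: orthonormal_basis_def orthonormal_family_def)
      finally show ?thesis .
    qed
    have "(\<Sum>l<n. t l) = (\<Sum>i\<in>I. \<Sum>l<n. (cmod (cinner n (q i) (v l)))\<^sup>2)" unfolding t_def by (rule sum.swap)
    also have "\<dots> = (\<Sum>i\<in>I. 1)"
      using q by (intro sum.cong refl) (auto simp: parseval[OF v(1), symmetric] orthonormal_family_def intro!: norm1)
    finally show "(\<Sum>l<n. t l) \<le> real k" using I by simp
  qed auto
  finally show ?thesis .
qed

section \<open>Bounds for the two quadratic forms\<close>

lemma low_rank_trace_bound:
  assumes B: "B \<in> carrier_mat m n"
  shows "(cmod (\<Sum>i<k. cinner m (mat_fun B (x i)) (w i)))\<^sup>2
    \<le> (\<Sum>l<min k n. (singular_value_list B ! l)\<^sup>2) * (\<Sum>p<m. \<Sum>s<n. (cmod (\<Sum>i<k. cnj (w i p) * x i s))\<^sup>2)"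
proof -
  obtain I q c where I: "I \<subseteq> {..<k}" and q: "orthonormal_family n I q"
    and x: "\<And>i s. i < k \<Longrightarrow> s < n \<Longrightarrow> x i s = (\<Sum>l\<in>I. c i l * q l s)"
    using orthonormalization[of k n x] by blast
  have fin: "finite I" and card: "card I \<le> k"
    using I finite_subset card_mono[of "{..<k}" I] by auto
  \<comment> \<open>Collecting the coefficients of each \<open>q l\<close> turns the sum of the x_i
    w_i* into the sum over \<open>I\<close> of the q_l u_l*.\<close>
  define u where "u l p = (\<Sum>i<k. cnj (c i l) * w i p)" for l p
  have "(\<Sum>i<k. cinner m (mat_fun B (x i)) (w i)) = (\<Sum>i<k. \<Sum>l\<in>I. c i l * cinner m (mat_fun B (q l)) (w i))"
  proof (intro sum.cong refl)
    fix i assume "i \<in> {..<k}"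
    then have "mat_fun B (x i) = (\<lambda>p. \<Sum>l\<in>I. c i l * mat_fun B (q l) p)"
      using B x[of i] unfolding mat_fun_sum[symmetric] by (intro ext mat_fun_cong) auto
    then show "cinner m (mat_fun B (x i)) (w i) = (\<Sum>l\<in>I. c i l * cinner m (mat_fun B (q l)) (w i))"
      by (simp only: cinner_sum_left)
  qed
  also have "\<dots> = (\<Sum>l\<in>I. \<Sum>i<k. c i l * cinner m (mat_fun B (q l)) (w i))" by (rule sum.swap)
  also have "\<dots> = (\<Sum>l\<in>I. cinner m (mat_fun B (q l)) (u l))"
  proof (intro sum.cong refl)
    fix l
    have "cinner m (mat_fun B (q l)) (u l) = cnj (\<Sum>i<k. cnj (c i l) * cinner m (w i) (mat_fun B (q l)))"
      unfolding cinner_sum_left[symmetric] u_def[abs_def] by (simp only: cnj_cinner)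
    then show "(\<Sum>i<k. c i l * cinner m (mat_fun B (q l)) (w i)) = cinner m (mat_fun B (q l)) (u l)" by (simp add: cnj_cinner)
  qed
  finally have Z: "(\<Sum>i<k. cinner m (mat_fun B (x i)) (w i)) = (\<Sum>z\<in>I \<times> {..<m}. mat_fun B (q (fst z)) (snd z) * cnj (u (fst z) (snd z)))"
    by (simp add: cinner_def sum.cartesian_product case_prod_unfold)
  \<comment> \<open>Orthonormality of the \<open>q l\<close> makes the squared Frobenius norm the
    sum of the squared norms of the \<open>u l\<close>.\<close>
  have M: "(\<Sum>p<m. \<Sum>s<n. (cmod (\<Sum>i<k. cnj (w i p) * x i s))\<^sup>2) = (\<Sum>l\<in>I. \<Sum>p<m. (cmod (u l p))\<^sup>2)"
  proof -
    have "(\<Sum>i<k. cnj (w i p) * x i s) = (\<Sum>l\<in>I. cnj (u l p) * q l s)" if "s < n" for p s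
    proof -
      have "(\<Sum>i<k. cnj (w i p) * x i s) = (\<Sum>i<k. \<Sum>l\<in>I. cnj (w i p) * (c i l * q l s))"
        using x that by (simp add: sum_distrib_left)
      also have "\<dots> = (\<Sum>l\<in>I. \<Sum>i<k. cnj (w i p) * (c i l * q l s))" by (rule sum.swap)
      finally show ?thesis by (simp add: u_def sum_distrib_left mult_ac)
    qed
    then have "(\<Sum>p<m. \<Sum>s<n. (cmod (\<Sum>i<k. cnj (w i p) * x i s))\<^sup>2) = (\<Sum>p<m. \<Sum>s<n. (cmod (\<Sum>l\<in>I. cnj (u l p) * q l s))\<^sup>2)"
      by simp
    also have "\<dots> = (\<Sum>p<m. \<Sum>l\<in>I. 1 * (cmod (cnj (u l p)))\<^sup>2)"
      using q fin by (intro sum.cong refl cinner_sum_sum) (auto simp: orthonormal_family_def)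
    also have "\<dots> = (\<Sum>l\<in>I. \<Sum>p<m. 1 * (cmod (cnj (u l p)))\<^sup>2)" by (rule sum.swap)
    finally show ?thesis by simp
  qed
  have "cmod (\<Sum>i<k. cinner m (mat_fun B (x i)) (w i)) \<le> (\<Sum>z\<in>I \<times> {..<m}. cmod (mat_fun B (q (fst z)) (snd z)) * cmod (u (fst z) (snd z)))"
    unfolding Z by (rule order_trans[OF norm_sum]) (simp add: norm_mult)
  then have "(cmod (\<Sum>i<k. cinner m (mat_fun B (x i)) (w i)))\<^sup>2
      \<le> (\<Sum>z\<in>I \<times> {..<m}. cmod (mat_fun B (q (fst z)) (snd z)) * cmod (u (fst z) (snd z)))\<^sup>2"
    by (intro power_mono) auto
  \<comment> \<open>A single Cauchy-Schwarz over all pairs of an index \<open>l\<close> and a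
    coordinate \<open>p\<close> separates \<open>q\<close> from \<open>u\<close>.\<close>
  also have "\<dots> \<le> (\<Sum>z\<in>I \<times> {..<m}. (cmod (mat_fun B (q (fst z)) (snd z)))\<^sup>2) * (\<Sum>z\<in>I \<times> {..<m}. (cmod (u (fst z) (snd z)))\<^sup>2)"
    by (rule Cauchy_Schwarz_ineq_sum)
  also have "\<dots> = (\<Sum>l\<in>I. \<Sum>p<m. (cmod (mat_fun B (q l) p))\<^sup>2) * (\<Sum>l\<in>I. \<Sum>p<m. (cmod (u l p))\<^sup>2)"
    by (simp add: sum.cartesian_product case_prod_unfold)
  also have "\<dots> \<le> (\<Sum>l<min k n. (singular_value_list B ! l)\<^sup>2) * (\<Sum>l\<in>I. \<Sum>p<m. (cmod (u l p))\<^sup>2)"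
    by (intro mult_right_mono ky_fan_inequality[OF B fin card q] sum_nonneg) auto
  finally show ?thesis unfolding M .
qed

text \<open>The operator norm of \<open>B\<close> is its largest singular value, whose square is one
  of the summands below \<alpha> because \<open>1 \<le> k\<close>.\<close>

lemma mat_fun_norm_le:
  assumes B: "B \<in> carrier_mat m n" and "1 \<le> k" and \<alpha>: "(\<Sum>l<min k n. (singular_value_list B ! l)\<^sup>2) \<le> \<alpha>"
  shows "(\<Sum>p<m. (cmod (mat_fun B f p))\<^sup>2) \<le> \<alpha> * (\<Sum>s<n. (cmod (f s))\<^sup>2)"
proof -
  let ?a = "\<lambda>l. (singular_value_list B ! l)\<^sup>2"
  obtain v where v: "orthonormal_basis n v"
    "\<And>i j. i < n \<Longrightarrow> j < n \<Longrightarrow> cinner m (mat_fun B (v i)) (mat_fun B (v j)) = (if i = j then of_real (?a i) else 0)"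
    using right_singular_basis[OF B] by blast
  have "?a l \<le> \<alpha>" if l: "l < n" for l
  proof -
    have "?a l \<le> ?a 0" using singular_value_list_antimono[OF B _ l] by simp
    also have "\<dots> \<le> (\<Sum>l<min k n. ?a l)" using l \<open>1 \<le> k\<close> by (intro member_le_sum) auto
    finally show ?thesis using \<alpha> by linarith
  qed
  then have "(\<Sum>l<n. ?a l * (cmod (cinner n f (v l)))\<^sup>2) \<le> (\<Sum>l<n. \<alpha> * (cmod (cinner n f (v l)))\<^sup>2)"
    by (intro sum_mono mult_right_mono) auto
  also have "\<dots> = \<alpha> * (\<Sum>s<n. (cmod (f s))\<^sup>2)" by (subst parseval[OF v(1)]) (rule sum_distrib_left[symmetric])
  also have "(\<Sum>l<n. ?a l * (cmod (cinner n f (v l)))\<^sup>2) = (\<Sum>p<m. (cmod (mat_fun B f p))\<^sup>2)"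
    by (rule mat_fun_norm_singular_basis[OF B v(1), symmetric]) (rule v(2))
  finally show ?thesis .
qed

subsection \<open>Positivity of the map\<close>

lemma cnj_index_Phi_minus:
  assumes B: "B \<in> carrier_mat m n" and X: "X \<in> carrier_mat n n" and Y: "Y \<in> carrier_mat n n"
    and XY: "\<And>s t. s < n \<Longrightarrow> t < n \<Longrightarrow> Y $$ (t, s) = cnj (X $$ (s, t))" and pq: "p < m" "q < m"
  shows "Phi_minus \<alpha> B Y $$ (q, p) = cnj (Phi_minus \<alpha> B X $$ (p, q))"
proof -
  have "(\<Sum>s<n. \<Sum>t<n. B $$ (q, s) * Y $$ (s, t) * cnj (B $$ (p, t)))
    = (\<Sum>t<n. \<Sum>s<n. B $$ (q, s) * Y $$ (s, t) * cnj (B $$ (p, t)))" by (rule sum.swap)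
  also have "\<dots> = cnj (\<Sum>s<n. \<Sum>t<n. B $$ (p, s) * X $$ (s, t) * cnj (B $$ (q, t)))"
    unfolding cnj_sum by (intro sum.cong refl) (simp add: XY mult_ac)
  finally show ?thesis
    unfolding index_Phi_minus[OF B X pq] index_Phi_minus[OF B Y pq(2,1)] by (simp add: XY)
qed

lemma block_form_sum:
  fixes F :: "nat \<Rightarrow> nat \<Rightarrow> nat \<Rightarrow> nat \<Rightarrow> nat \<Rightarrow> complex"
  shows "(\<Sum>i<k. \<Sum>p<m. (\<Sum>j<k. \<Sum>q<m. (\<Sum>l<N. F l i j p q) * y j q) * cnj (y i p))
    = (\<Sum>l<N. \<Sum>i<k. \<Sum>p<m. (\<Sum>j<k. \<Sum>q<m. F l i j p q * y j q) * cnj (y i p))"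
proof (induction N)
  case (Suc N)
  then show ?case by (simp add: distrib_right sum.distrib)
qed simp

text \<open>Both forms are sums over the rank one summands of the block matrix. Each summand is
  handled by \<open>low_rank_trace_bound\<close> for the image itself and by
  \<open>mat_fun_norm_le\<close> for its partial transpose.\<close>

lemma Phi_minus_k_PPT:
  assumes B: "B \<in> carrier_mat m n" and k: "1 \<le> k"
    and \<alpha>: "(\<Sum>l<min k n. (singular_value_list B ! l)\<^sup>2) \<le> \<alpha>"
  shows "k_PPT k n m (Phi_minus \<alpha> B)"
  unfolding k_PPT_def
proof (intro conjI allI impI linear_Phi_minus[OF B])
  fix A :: "nat \<Rightarrow> nat \<Rightarrow> complex mat"
  assume carr: "\<forall>i<k. \<forall>j<k. A i j \<in> carrier_mat n n" and psd: "positive_semidefinite (block_matrix k n A)"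
  let ?N = "k * n"
  have "block_matrix k n A \<in> carrier_mat ?N ?N" by (simp add: block_matrix_def)
  from positive_semidefinite_decomposition[OF this psd] obtain z
    where z: "\<And>i j. i < ?N \<Longrightarrow> j < ?N \<Longrightarrow> block_matrix k n A $$ (i, j) = (\<Sum>l<?N. z l i * cnj (z l j))" by blast
  \<comment> \<open>Each vector of length \<open>k * n\<close> is cut into \<open>k\<close> pieces
    of length \<open>n\<close>.\<close>
  define x where "x l i s = z l (i * n + s)" for l i s
  have A: "A i j $$ (s, t) = (\<Sum>l<?N. x l i s * cnj (x l j t))" if "i < k" "j < k" "s < n" "t < n" for i j s t
    using z[OF block_index_less[OF that(1,3)] block_index_less[OF that(2,4)]] that
      block_index_less[OF that(1,3)] block_index_less[OF that(2,4)]
    by (simp add: block_matrix_def x_def)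
  have herm: "\<forall>i<k. \<forall>j<k. \<forall>p<n. \<forall>q<n. A j i $$ (q, p) = cnj (A i j $$ (p, q))"
    using psd unfolding positive_semidefinite_block_matrix_iff by blast
  have Phi_herm: "Phi_minus \<alpha> B (A j i) $$ (q, p) = cnj (Phi_minus \<alpha> B (A i j) $$ (p, q))"
    if "i < k" "j < k" "p < m" "q < m" for i j p q
    using carr herm that by (intro cnj_index_Phi_minus[OF B]) blast+
  have entry: "Phi_minus \<alpha> B (A i j) $$ (p, q) = (\<Sum>l<?N.
      (if p = q then of_real \<alpha> * cinner n (x l i) (x l j) else 0) - mat_fun B (x l i) p * cnj (mat_fun B (x l j) q))"
    if "i < k" "j < k" "p < m" "q < m" for i j p q
    using carr that by (intro index_Phi_minus_gram[OF B]) (auto simp: A)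
  have pos: "0 \<le> (\<Sum>i<k. \<Sum>p<m. (\<Sum>j<k. \<Sum>q<m. Phi_minus \<alpha> B (A i j) $$ (p, q) * w j q) * cnj (w i p))" for w
  proof -
    have "0 \<le> complex_of_real (\<alpha> * (\<Sum>p<m. \<Sum>s<n. (cmod (\<Sum>i<k. cnj (w i p) * x l i s))\<^sup>2)
        - (cmod (\<Sum>i<k. cinner m (mat_fun B (x l i)) (w i)))\<^sup>2)" for l
    proof -
      have "(\<Sum>l<min k n. (singular_value_list B ! l)\<^sup>2) * (\<Sum>p<m. \<Sum>s<n. (cmod (\<Sum>i<k. cnj (w i p) * x l i s))\<^sup>2)
        \<le> \<alpha> * (\<Sum>p<m. \<Sum>s<n. (cmod (\<Sum>i<k. cnj (w i p) * x l i s))\<^sup>2)"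
        by (intro mult_right_mono \<alpha> sum_nonneg) auto
      with low_rank_trace_bound[OF B, where k = k and x = "x l" and w = w]
      show ?thesis by (simp add: less_eq_complex_def)
    qed
    then have "0 \<le> (\<Sum>l<?N. \<Sum>i<k. \<Sum>p<m. (\<Sum>j<k. \<Sum>q<m.
      ((if p = q then of_real \<alpha> * cinner n (x l i) (x l j) else 0) - mat_fun B (x l i) p * cnj (mat_fun B (x l j) q)) * w j q) * cnj (w i p))"
      unfolding Phi_minus_form by (intro sum_nonneg)
    also have "\<dots> = (\<Sum>i<k. \<Sum>p<m. (\<Sum>j<k. \<Sum>q<m. Phi_minus \<alpha> B (A i j) $$ (p, q) * w j q) * cnj (w i p))"
      unfolding block_form_sum[symmetric] by (intro sum.cong refl arg_cong2[where f = "(*)"]) (simp add: entry)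
    finally show ?thesis .
  qed
  have pos_transpose: "0 \<le> (\<Sum>i<k. \<Sum>p<m. (\<Sum>j<k. \<Sum>q<m. Phi_minus \<alpha> B (A j i) $$ (p, q) * w j q) * cnj (w i p))" for w
  proof -
    have "0 \<le> complex_of_real (\<alpha> * (\<Sum>p<m. \<Sum>s<n. (cmod (\<Sum>i<k. w i p * x l i s))\<^sup>2))
        - (\<Sum>p<m. \<Sum>q<m. mat_fun B (\<lambda>s. \<Sum>i<k. w i q * x l i s) p * cnj (mat_fun B (\<lambda>s. \<Sum>i<k. w i p * x l i s) q))" for l
    proof -
      define Y where "Y p s = (\<Sum>i<k. w i p * x l i s)" for p s
      let ?N = "\<lambda>p q. mat_fun B (Y q) p"
      let ?D = "\<Sum>p<m. \<Sum>q<m. ?N p q * cnj (?N q p)"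
      \<comment> \<open>Conjugation exchanges \<open>p\<close> and \<open>q\<close>, so
        \<open>?D\<close> is real; the order on complex numbers demands this besides the bound on
        the real part.\<close>
      have "cnj ?D = (\<Sum>p<m. \<Sum>q<m. ?N q p * cnj (?N p q))" by (simp add: mult.commute)
      also have "\<dots> = ?D" by (rule sum.swap)
      finally have "cnj ?D = ?D" .
      then have real: "Im ?D = 0" using complex_is_Real_iff Reals_cnj_iff by blast
      \<comment> \<open>This is the expansion of |a - b|^2 \<ge> 0. Applied to opposite entries, it
        bounds \<open>Re ?D\<close> by the squared Frobenius norm of N, which is then estimated
        column by column.\<close>
      have "Re (a * cnj b) \<le> ((cmod a)\<^sup>2 + (cmod b)\<^sup>2) / 2" for a b :: complex
        unfolding cmod_power2 using sum_squares_ge_zero[of "Re a - Re b" "Im a - Im b"]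
        by (simp add: power2_eq_square algebra_simps)
      then have "Re ?D \<le> (\<Sum>p<m. \<Sum>q<m. ((cmod (?N p q))\<^sup>2 + (cmod (?N q p))\<^sup>2) / 2)"
        unfolding Re_sum by (intro sum_mono)
      also have "\<dots> = ((\<Sum>p<m. \<Sum>q<m. (cmod (?N p q))\<^sup>2) + (\<Sum>p<m. \<Sum>q<m. (cmod (?N q p))\<^sup>2)) / 2"
        by (simp add: sum_divide_distrib sum.distrib add_divide_distrib)
      also have "(\<Sum>p<m. \<Sum>q<m. (cmod (?N p q))\<^sup>2) = (\<Sum>p<m. \<Sum>q<m. (cmod (?N q p))\<^sup>2)" by (rule sum.swap)
      also have "((\<Sum>p<m. \<Sum>q<m. (cmod (?N q p))\<^sup>2) + (\<Sum>p<m. \<Sum>q<m. (cmod (?N q p))\<^sup>2)) / 2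
        = (\<Sum>p<m. \<Sum>q<m. (cmod (mat_fun B (Y p) q))\<^sup>2)" by simp
      also have "\<dots> \<le> (\<Sum>p<m. \<alpha> * (\<Sum>s<n. (cmod (Y p s))\<^sup>2))"
        by (intro sum_mono mat_fun_norm_le[OF B k \<alpha>])
      also have "\<dots> = \<alpha> * (\<Sum>p<m. \<Sum>s<n. (cmod (Y p s))\<^sup>2)" by (simp add: sum_distrib_left)
      finally show ?thesis using real unfolding Y_def[abs_def] less_eq_complex_def by simp
    qed
    then have "0 \<le> (\<Sum>l<?N. \<Sum>i<k. \<Sum>p<m. (\<Sum>j<k. \<Sum>q<m.
      ((if p = q then of_real \<alpha> * cinner n (x l j) (x l i) else 0) - mat_fun B (x l j) p * cnj (mat_fun B (x l i) q)) * w j q) * cnj (w i p))"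
      unfolding Phi_minus_form_transpose by (intro sum_nonneg)
    also have "\<dots> = (\<Sum>i<k. \<Sum>p<m. (\<Sum>j<k. \<Sum>q<m. Phi_minus \<alpha> B (A j i) $$ (p, q) * w j q) * cnj (w i p))"
      unfolding block_form_sum[symmetric] by (intro sum.cong refl arg_cong2[where f = "(*)"]) (simp add: entry)
    finally show ?thesis .
  qed
  show "PPT k m (\<lambda>i j. Phi_minus \<alpha> B (A i j))"
    unfolding PPT_def partial_transpose_def positive_semidefinite_block_matrix_iff
    using Phi_herm pos pos_transpose by blast
qed

section \<open>Necessity of the singular value bound\<close>

lemma k_positive_Phi_minus_bound:
  assumes B: "B \<in> carrier_mat m n" and pos: "k_positive k n m (Phi_minus \<alpha> B)"
  shows "(cmod (\<Sum>i<k. cinner m (mat_fun B (x i)) (w i)))\<^sup>2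
    \<le> \<alpha> * (\<Sum>p<m. \<Sum>s<n. (cmod (\<Sum>i<k. cnj (w i p) * x i s))\<^sup>2)"
proof -
  define A where "A i j = mat n n (\<lambda>(s, t). x i s * cnj (x j t))" for i j
  have carr: "A i j \<in> carrier_mat n n" for i j by (simp add: A_def)
  have "positive_semidefinite (block_matrix k n A)"
    unfolding positive_semidefinite_block_matrix_iff
  proof (intro conjI allI impI)
    fix y :: "nat \<Rightarrow> nat \<Rightarrow> complex"
    \<comment> \<open>The inner product of \<open>x\<close> and \<open>y\<close> as vectors of
      length \<open>k * n\<close>; the form of the rank one test matrix at \<open>y\<close> is its
      squared modulus.\<close>
    let ?Z = "\<Sum>i<k. \<Sum>p<n. x i p * cnj (y i p)"
    have cnjZ: "cnj ?Z = (\<Sum>j<k. \<Sum>q<n. cnj (x j q) * y j q)" by simp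
    have "(\<Sum>i<k. \<Sum>p<n. (\<Sum>j<k. \<Sum>q<n. A i j $$ (p, q) * y j q) * cnj (y i p))
      = (\<Sum>i<k. \<Sum>p<n. x i p * cnj ?Z * cnj (y i p))"
      unfolding cnjZ by (intro sum.cong refl) (simp add: A_def sum_distrib_left mult.assoc)
    also have "\<dots> = ?Z * cnj ?Z" unfolding sum_distrib_right by (simp only: mult_ac)
    finally show "0 \<le> (\<Sum>i<k. \<Sum>p<n. (\<Sum>j<k. \<Sum>q<n. A i j $$ (p, q) * y j q) * cnj (y i p))"
      by (simp only: complex_norm_square[symmetric]) (simp add: less_eq_complex_def)
  qed (simp add: A_def)
  with pos carr have "positive_semidefinite (block_matrix k m (\<lambda>i j. Phi_minus \<alpha> B (A i j)))"
    unfolding k_positive_def by blast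
  then have "0 \<le> (\<Sum>i<k. \<Sum>p<m. (\<Sum>j<k. \<Sum>q<m. Phi_minus \<alpha> B (A i j) $$ (p, q) * w j q) * cnj (w i p))"
    unfolding positive_semidefinite_block_matrix_iff by blast
  also have "\<dots> = (\<Sum>i<k. \<Sum>p<m. (\<Sum>j<k. \<Sum>q<m.
      ((if p = q then of_real \<alpha> * cinner n (x i) (x j) else 0) - mat_fun B (x i) p * cnj (mat_fun B (x j) q)) * w j q) * cnj (w i p))"
  proof (intro sum.cong refl arg_cong2[where f = "(*)"])
    fix i p j q assume "p \<in> {..<m}" "q \<in> {..<m}"
    then have pq: "p < m" "q < m" by auto
    \<comment> \<open>A sum with one term, matching \<open>index_Phi_minus_gram\<close> with
      \<open>N = 1\<close>.\<close>
    have gram: "A i j $$ (s, t) = (\<Sum>l<Suc 0. x i s * cnj (x j t))" if "s < n" "t < n" for s t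
      using that by (simp add: A_def)
    from index_Phi_minus_gram[OF B carr pq gram] show "Phi_minus \<alpha> B (A i j) $$ (p, q) = (if p = q then of_real \<alpha> * cinner n (x i) (x j) else 0) - mat_fun B (x i) p * cnj (mat_fun B (x j) q)"
      by simp
  qed
  finally show ?thesis unfolding Phi_minus_form by (simp add: less_eq_complex_def)
qed

text \<open>The equality case: with x_i = v_i and w_i = B v_i, both tr (B Y) and the squared
  Frobenius norm of Y equal \<open>?S\<close>, so \<open>?S\<^sup>2 \<le> \<alpha> * ?S\<close>.
  Division by \<open>?S\<close> settles the case \<open>?S > 0\<close>; otherwise
  \<open>0 \<le> \<alpha>\<close> is what remains to be known.\<close>

lemma k_positive_Phi_minus_ge:
  assumes B: "B \<in> carrier_mat m n" and k: "1 \<le> k" and m: "1 \<le> m" and n: "1 \<le> n"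
    and pos: "k_positive k n m (Phi_minus \<alpha> B)"
  shows "(\<Sum>l<min k n. (singular_value_list B ! l)\<^sup>2) \<le> \<alpha>"
proof -
  let ?a = "\<lambda>l. (singular_value_list B ! l)\<^sup>2"
  let ?S = "\<Sum>l<min k n. ?a l"
  let ?J = "{..<min k n}"
  obtain v where v: "orthonormal_basis n v"
    "\<And>i j. i < n \<Longrightarrow> j < n \<Longrightarrow> cinner m (mat_fun B (v i)) (mat_fun B (v j)) = (if i = j then of_real (?a i) else 0)"
    using right_singular_basis[OF B] by blast
  have k_sum: "(\<Sum>i<k. if i \<in> ?J then f i else 0) = (\<Sum>i\<in>?J. f i)" for f :: "nat \<Rightarrow> complex"
  proof -
    have "(\<Sum>i<k. if i \<in> ?J then f i else 0) = (\<Sum>i\<in>{..<k} \<inter> ?J. f i)" by (subst sum.inter_restrict) auto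
    also have "{..<k} \<inter> ?J = ?J" by auto
    finally show ?thesis .
  qed
  \<comment> \<open>For \<open>k > n\<close> only \<open>n\<close> singular vectors exist; zero
    vectors \<open>?w i\<close> remove the contribution of the further \<open>v i\<close>.\<close>
  let ?w = "\<lambda>i p. if i \<in> ?J then mat_fun B (v i) p else 0"
  have "(\<Sum>i<k. cinner m (mat_fun B (v i)) (?w i)) = (\<Sum>i<k. if i \<in> ?J then of_real (?a i) else 0)"
    using v(2) by (intro sum.cong refl) (auto simp: cinner_def)
  then have Z: "(\<Sum>i<k. cinner m (mat_fun B (v i)) (?w i)) = of_real ?S" unfolding k_sum by simp
  have "(\<Sum>p<m. \<Sum>s<n. (cmod (\<Sum>i<k. cnj (?w i p) * v i s))\<^sup>2)
      = (\<Sum>p<m. \<Sum>s<n. (cmod (\<Sum>i\<in>?J. cnj (mat_fun B (v i) p) * v i s))\<^sup>2)"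
    unfolding k_sum[symmetric] by (intro sum.cong refl arg_cong[where f = "\<lambda>z. (cmod z)\<^sup>2"]) auto
  also have "\<dots> = (\<Sum>p<m. \<Sum>i\<in>?J. 1 * (cmod (cnj (mat_fun B (v i) p)))\<^sup>2)"
  proof (rule sum.cong[OF refl])
    fix p
    show "(\<Sum>s<n. (cmod (\<Sum>i\<in>?J. cnj (mat_fun B (v i) p) * v i s))\<^sup>2) = (\<Sum>i\<in>?J. 1 * (cmod (cnj (mat_fun B (v i) p)))\<^sup>2)"
      by (rule cinner_sum_sum[where d = "\<lambda>_. 1" and q = v and c = "\<lambda>i. cnj (mat_fun B (v i) p)"])
        (use v(1) in \<open>auto simp: orthonormal_basis_def orthonormal_family_def\<close>)
  qed
  also have "\<dots> = (\<Sum>i\<in>?J. \<Sum>p<m. 1 * (cmod (cnj (mat_fun B (v i) p)))\<^sup>2)" by (rule sum.swap)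
  also have "\<dots> = ?S"
  proof (intro sum.cong refl)
    fix i assume "i \<in> ?J"
    then have "complex_of_real (\<Sum>p<m. (cmod (mat_fun B (v i) p))\<^sup>2) = of_real (?a i)"
      using v(2)[of i i] unfolding cinner_self by simp
    then show "(\<Sum>p<m. 1 * (cmod (cnj (mat_fun B (v i) p)))\<^sup>2) = ?a i"
      unfolding of_real_eq_iff by simp
  qed
  finally have "?S\<^sup>2 \<le> \<alpha> * ?S"
    using k_positive_Phi_minus_bound[OF B pos, of v ?w] unfolding Z norm_of_real power2_abs by simp
  \<comment> \<open>Here Y is a matrix unit: every x_i is the first unit vector, and so is w_0,
    while the other w_i vanish. Its norm is 1, so the bound puts a square below \<alpha>.\<close>
  moreover have "0 \<le> \<alpha>"
  proof -
    have "(\<Sum>p<m. \<Sum>s<n. (cmod (\<Sum>i<k. cnj (if i = 0 \<and> p = 0 then 1 else 0) * (if s = 0 then 1 else 0)))\<^sup>2) = (1 :: real)"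
    proof -
      have "(\<Sum>i<k. cnj (if i = 0 \<and> p = 0 then 1 else 0) * (if s = 0 then 1 else 0))
        = (if p = 0 \<and> s = 0 then 1 else 0)" for p s :: nat
      proof -
        have "(\<Sum>i<k. cnj (if i = 0 \<and> p = 0 then 1 else 0) * (if s = 0 then 1 else 0))
          = (\<Sum>i<k. if i = 0 then if p = 0 \<and> s = 0 then 1 else 0 else 0)"
          by (intro sum.cong) auto
        then show ?thesis using k by simp
      qed
      then have "(\<Sum>p<m. \<Sum>s<n. (cmod (\<Sum>i<k. cnj (if i = 0 \<and> p = 0 then 1 else 0) * (if s = 0 then 1 else 0)))\<^sup>2)
        = (\<Sum>p<m. \<Sum>s<n. if s = 0 then if p = 0 then 1 else 0 else 0)"
        by (intro sum.cong refl) auto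
      then show ?thesis using m n by simp
    qed
    with k_positive_Phi_minus_bound[OF B pos, of "\<lambda>i s. if s = 0 then 1 else 0" "\<lambda>i p. if i = 0 \<and> p = 0 then 1 else 0"]
    show ?thesis by (smt (verit) zero_le_power2 mult_cancel_left1 mult.right_neutral)
  qed
  moreover have "0 \<le> ?S" by (intro sum_nonneg) auto
  ultimately show ?thesis by (cases "?S = 0") (auto simp: power2_eq_square mult_le_cancel_right)
qed

text \<open>The implications form a cycle: positivity is the first half of PPT, it forces the bound
  on \<alpha>, and the bound gives back the full PPT property.\<close>

theorem corollary4p12:
  fixes m n k :: nat and \<alpha> :: real and B :: "complex mat"
  assumes "m \<ge> 1" and "n \<ge> 1" and "1 \<le> k" and "k \<le> m"
    and "B \<in> carrier_mat m n"
  shows "(k_PPT k n m (Phi_minus \<alpha> B) \<longleftrightarrow> k_positive k n m (Phi_minus \<alpha> B)) \<and>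
         (k_positive k n m (Phi_minus \<alpha> B) \<longleftrightarrow> \<alpha> \<ge> (\<Sum>j = 1..k. (singular_value B j)\<^sup>2))"
proof -
  have "k_PPT k n m (Phi_minus \<alpha> B) \<Longrightarrow> k_positive k n m (Phi_minus \<alpha> B)"
    unfolding k_PPT_def k_positive_def PPT_def by blast
  then show ?thesis
    using Phi_minus_k_PPT[of B m n k \<alpha>] k_positive_Phi_minus_ge[of B m n k \<alpha>] assms
    unfolding sum_singular_values[OF assms(5,4)] by blast
qed

end
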